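(* Let $n \in \mathbb{N}$ and let $\mathcal{S}$ be an operator system in a unital C*-algebra $\mathcal{A}$. Then every positive linear map $\psi : \mathcal{S} \to M_n$ is decomposable if and only if $J_n(\mathcal{S}) \subseteq \overline{\mathcal{S}^+ \otimes M_n^+}$.
   Context: Every unital C*-algebra $\mathcal{A}$ is regarded as a C*-subalgebra of $B(H)$ (the bounded operators on a complex Hilbert space $H$), sharing its unit. An operator system $\mathcal{S} \subseteq \mathcal{A}$ is a self-adjoint linear subspace of $\mathcal{A}$ containing the unit. $M_n = B(\mathbb{C}^n)$ is the C*-algebra of $n \times n$ complex matrices, and $\succeq 0$ means positive (semidefinite). $\mathcal{S}^+$ is the set of positive elements of $\mathcal{S}$ (positivity taken in $B(H)$), and $M_n^+$ is the set of positive semidefinite matrices. For $k \in \mathbb{N}$, $\mathcal{S} \otimes M_k$ (algebraic tensor product) is regarded as a subspace of $B(H) \otimes M_k = B(\oplus_1^k H)$, and positivity and norm on it are inherited from there. $\mathcal{S}^+ \otimes M_n^+$ denotes the convex cone in $\mathcal{S} \otimes M_n$ generated by the elementary tensors $s \otimes X$ with $s \in \mathcal{S}^+$, $X \in M_n^+$; the bar denotes closure in $\mathcal{S} \otimes M_n$ (norm topology). A linear map $\phi : \mathcal{S} \to M_n$ is positive if $\phi(s) \succeq 0$ for all $s \in \mathcal{S}^+$. It is completely positive (cp) if for every $k \in \mathbb{N}$ the map $\phi_k : \mathcal{S} \otimes M_k \to M_n \otimes M_k = B(\mathbb{C}^n \otimes \mathbb{C}^k)$ determined by $\phi_k(s \otimes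 X) = \phi(s) \otimes X$ sends positive elements to positive elements. It is co-cp if $t \circ \phi$ is cp, where $t$ is a transpose on $M_n$ (with respect to an orthonormal basis; the notion does not depend on the choice). It is decomposable if it is a sum of a cp map and a co-cp map. For $k \in \mathbb{N}$ and $t$ a transpose on $M_k$, $$J_k(\mathcal{S}) = \Big\{ S = \sum_j s_j \otimes x_j \in \mathcal{S} \otimes M_k \ (\text{finite sum}) : S \succeq 0 \text{ and } \sum_j s_j \otimes t(x_j) \succeq 0 \Big\},$$ i.e. the positive elements $S$ of $\mathcal{S} \otimes M_k$ whose partial transpose $(I \otimes t)(S)$ is also positive ($I$ the identity map on $\mathcal{S}$). This does not depend on the choice of transpose. *)

theory Defs
  imports "HOL-Analysis.Bounded_Linear_Function" "Jordan_Normal_Form.Matrix"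
begin

section \<open>Complex Hilbert spaces and their bounded operators\<close>

text \<open>
  A complex Hilbert space is a complete real inner product space with a compatible complex
  structure: the norm and the topology are those of the real inner product
  \<open>x \<bullet> y = Re \<langle>x, y\<rangle>\<close>.  The complex inner product is conjugate linear in its first argument.
\<close>

class chilbert_space = real_inner + complete_space +
  fixes scaleC :: "complex \<Rightarrow> 'a \<Rightarrow> 'a"  (infixr \<open>*\<^sub>C\<close> 75)
    and cinner :: "'a \<Rightarrow> 'a \<Rightarrow> complex"
  assumes scaleC_add_right: "c *\<^sub>C (x + y) = c *\<^sub>C x + c *\<^sub>C y"
    and scaleC_add_left: "(c + d) *\<^sub>C x = c *\<^sub>C x + d *\<^sub>C x"
    and scaleC_scaleC: "c *\<^sub>C d *\<^sub>C x = (c * d) *\<^sub>C x"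
    and scaleC_of_real: "complex_of_real r *\<^sub>C x = scaleR r x"
    and cinner_commute: "cinner x y = cnj (cinner y x)"
    and cinner_add_right: "cinner x (y + z) = cinner x y + cinner x z"
    and cinner_scaleC_right: "cinner x (c *\<^sub>C y) = c * cinner x y"
    and inner_eq_Re_cinner: "inner x y = Re (cinner x y)"

lemma cinner_self: "cinner x x = complex_of_real ((norm x)\<^sup>2)"
  for x :: "'h::chilbert_space"
proof -
  have "Im (cinner x x) = 0"
    using arg_cong[OF cinner_commute[of x x], of Im] by simp
  moreover have "Re (cinner x x) = (norm x)\<^sup>2"
    by (simp add: power2_norm_eq_inner inner_eq_Re_cinner)
  ultimately show ?thesis by (simp add: complex_eq_iff)
qed

lemma cinner_scaleC_left: "cinner (c *\<^sub>C x) y = cnj c * cinner x y"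
  for x :: "'h::chilbert_space"
  by (metis cinner_commute cinner_scaleC_right complex_cnj_mult)

lemma norm_scaleC: "norm (c *\<^sub>C x) = cmod c * norm x"
  for x :: "'h::chilbert_space"
proof -
  have "complex_of_real ((norm (c *\<^sub>C x))\<^sup>2) = cnj c * c * cinner x x"
    by (simp only: cinner_self[symmetric] cinner_scaleC_left cinner_scaleC_right ac_simps)
  also have "\<dots> = complex_of_real ((cmod c * norm x)\<^sup>2)"
    by (simp add: cinner_self complex_norm_square[unfolded of_real_power] power_mult_distrib mult.commute)
  finally have "(norm (c *\<^sub>C x))\<^sup>2 = (cmod c * norm x)\<^sup>2"
    by (simp only: of_real_eq_iff)
  then show ?thesis by (simp add: power2_eq_iff_nonneg)
qed

lemma bounded_linear_scaleC: "bounded_linear (\<lambda>x::'h::chilbert_space. c *\<^sub>C x)"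
proof (rule bounded_linear_intro[where K = "cmod c"])
  show "c *\<^sub>C (r *\<^sub>R x) = r *\<^sub>R (c *\<^sub>C x)" for r and x :: 'h
    by (simp add: scaleC_of_real[symmetric] scaleC_scaleC mult.commute)
qed (simp_all add: scaleC_add_right norm_scaleC mult.commute)

text \<open>
  The type \<open>'h \<Rightarrow>\<^sub>L 'h\<close> consists of the bounded \<^emph>\<open>real\<close>-linear operators; \<open>B(H)\<close> is the
  subset of the complex linear ones, with the inherited norm, sum and composition.
\<close>

definition BH :: "('h::chilbert_space \<Rightarrow>\<^sub>L 'h) set" where
  "BH = {T. \<forall>c x. blinfun_apply T (c *\<^sub>C x) = c *\<^sub>C blinfun_apply T x}"

lift_definition scaleC_op :: "complex \<Rightarrow> ('h::chilbert_space \<Rightarrow>\<^sub>L 'h) \<Rightarrow> ('h \<Rightarrow>\<^sub>L 'h)"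
  is "\<lambda>c T x. c *\<^sub>C T x"
  by (rule bounded_linear_compose[OF bounded_linear_scaleC])

definition is_adjoint :: "('h::chilbert_space \<Rightarrow>\<^sub>L 'h) \<Rightarrow> ('h \<Rightarrow>\<^sub>L 'h) \<Rightarrow> bool" where
  "is_adjoint T T' \<longleftrightarrow>
    (\<forall>x y. cinner (blinfun_apply T x) y = cinner x (blinfun_apply T' y))"

text \<open>Here and below \<open>0 \<le> z\<close>, for complex \<open>z\<close>, means that \<open>z\<close> is real and nonnegative.\<close>

definition pos_op :: "('h::chilbert_space \<Rightarrow>\<^sub>L 'h) \<Rightarrow> bool" where
  "pos_op T \<longleftrightarrow> T \<in> BH \<and> (\<forall>x. 0 \<le> cinner x (blinfun_apply T x))"

definition csubspace_op :: "('h::chilbert_space \<Rightarrow>\<^sub>L 'h) set \<Rightarrow> bool" where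
  "csubspace_op V \<longleftrightarrow> V \<subseteq> BH \<and> 0 \<in> V \<and> (\<forall>s\<in>V. \<forall>t\<in>V. s + t \<in> V) \<and>
    (\<forall>c. \<forall>s\<in>V. scaleC_op c s \<in> V)"

definition selfadjoint_set :: "('h::chilbert_space \<Rightarrow>\<^sub>L 'h) set \<Rightarrow> bool" where
  "selfadjoint_set V \<longleftrightarrow> (\<forall>s\<in>V. \<exists>s'\<in>V. is_adjoint s s')"

definition unital_cstar_subalgebra :: "('h::chilbert_space \<Rightarrow>\<^sub>L 'h) set \<Rightarrow> bool" where
  "unital_cstar_subalgebra A \<longleftrightarrow> csubspace_op A \<and> selfadjoint_set A \<and> id_blinfun \<in> A \<and>
    (\<forall>s\<in>A. \<forall>t\<in>A. s o\<^sub>L t \<in> A) \<and> closed A"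

definition operator_system ::
    "('h::chilbert_space \<Rightarrow>\<^sub>L 'h) set \<Rightarrow> ('h \<Rightarrow>\<^sub>L 'h) set \<Rightarrow> bool" where
  "operator_system A S \<longleftrightarrow> S \<subseteq> A \<and> csubspace_op S \<and> selfadjoint_set S \<and> id_blinfun \<in> S"

definition pos_part :: "('h::chilbert_space \<Rightarrow>\<^sub>L 'h) set \<Rightarrow> ('h \<Rightarrow>\<^sub>L 'h) set" where
  "pos_part S = {s \<in> S. pos_op s}"

instantiation complex :: chilbert_space
begin

definition scaleC_complex :: "complex \<Rightarrow> complex \<Rightarrow> complex" where
  "scaleC_complex c z = c * z"

definition cinner_complex :: "complex \<Rightarrow> complex \<Rightarrow> complex" where
  "cinner_complex w z = cnj w * z"

instance
  by intro_classes
    (simp_all add: scaleC_complex_def cinner_complex_def algebra_simps inner_complex_def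
      scaleR_conv_of_real)

end

section \<open>Operator matrices: \<open>B(H) \<otimes> M\<^sub>k = B(H \<oplus> \<dots> \<oplus> H)\<close>\<close>

text \<open>
  A vector of \<open>\<oplus>\<^sub>1\<^sup>k H\<close> is an element of \<open>carrier_vec k :: 'h vec set\<close>, an operator on it is a
  \<open>k \<times> k\<close> matrix over \<open>B(H)\<close>.
\<close>

definition dsum_inner :: "'h::chilbert_space vec \<Rightarrow> 'h vec \<Rightarrow> complex" where
  "dsum_inner g h = (\<Sum>a<dim_vec h. cinner (g $ a) (h $ a))"

definition dsum_norm :: "'h::chilbert_space vec \<Rightarrow> real" where
  "dsum_norm h = sqrt (Re (dsum_inner h h))"

definition opmat_apply :: "('h::chilbert_space \<Rightarrow>\<^sub>L 'h) mat \<Rightarrow> 'h vec \<Rightarrow> 'h vec" where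
  "opmat_apply T h =
    vec (dim_row T) (\<lambda>a. \<Sum>b<dim_col T. blinfun_apply (T $$ (a, b)) (h $ b))"

definition opmat_pos :: "nat \<Rightarrow> ('h::chilbert_space \<Rightarrow>\<^sub>L 'h) mat \<Rightarrow> bool" where
  "opmat_pos k T \<longleftrightarrow> T \<in> carrier_mat k k \<and>
    (\<forall>h\<in>carrier_vec k. 0 \<le> dsum_inner h (opmat_apply T h))"

definition opmat_norm :: "nat \<Rightarrow> ('h::chilbert_space \<Rightarrow>\<^sub>L 'h) mat \<Rightarrow> real" where
  "opmat_norm k T = Sup {dsum_norm (opmat_apply T h) | h. h \<in> carrier_vec k \<and> dsum_norm h \<le> 1}"

text \<open>
  The element \<open>\<Sum>\<^sub>j s\<^sub>j \<otimes> x\<^sub>j\<close> \<open>(j < m)\<close> of \<open>B(H) \<otimes> M\<^sub>k\<close>; the elementary tensor \<open>s \<otimes> x\<close> is the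
  operator matrix with entries \<open>x\<^sub>a\<^sub>b s\<close>.
\<close>

definition tensor_sum ::
    "nat \<Rightarrow> nat \<Rightarrow> (nat \<Rightarrow> 'h::chilbert_space \<Rightarrow>\<^sub>L 'h) \<Rightarrow> (nat \<Rightarrow> complex mat) \<Rightarrow> ('h \<Rightarrow>\<^sub>L 'h) mat" where
  "tensor_sum k m s x = mat k k (\<lambda>(a, b). \<Sum>j<m. scaleC_op (x j $$ (a, b)) (s j))"

definition tensor_space ::
    "('h::chilbert_space \<Rightarrow>\<^sub>L 'h) set \<Rightarrow> nat \<Rightarrow> ('h \<Rightarrow>\<^sub>L 'h) mat set" where
  "tensor_space S k = {tensor_sum k m s x | m s x.
    \<forall>j<m. s j \<in> S \<and> x j \<in> carrier_mat k k}"

definition Jset :: "nat \<Rightarrow> ('h::chilbert_space \<Rightarrow>\<^sub>L 'h) set \<Rightarrow> ('h \<Rightarrow>\<^sub>L 'h) mat set" where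
  "Jset k S = {tensor_sum k m s x | m s x.
    (\<forall>j<m. s j \<in> S \<and> x j \<in> carrier_mat k k) \<and>
    opmat_pos k (tensor_sum k m s x) \<and>
    opmat_pos k (tensor_sum k m s (\<lambda>j. transpose_mat (x j)))}"

definition psd_mat :: "nat \<Rightarrow> complex mat \<Rightarrow> bool" where
  "psd_mat n X \<longleftrightarrow> X \<in> carrier_mat n n \<and> (\<forall>v\<in>carrier_vec n. 0 \<le> (X *\<^sub>v v) \<bullet>c v)"

definition pos_tensor_cone ::
    "('h::chilbert_space \<Rightarrow>\<^sub>L 'h) set \<Rightarrow> nat \<Rightarrow> ('h \<Rightarrow>\<^sub>L 'h) mat set" where
  "pos_tensor_cone S n = {tensor_sum n m (\<lambda>j. c j *\<^sub>R s j) x | m c s x.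
    \<forall>j<m. 0 \<le> c j \<and> s j \<in> pos_part S \<and> psd_mat n (x j)}"

definition tensor_closure ::
    "('h::chilbert_space \<Rightarrow>\<^sub>L 'h) set \<Rightarrow> nat \<Rightarrow> ('h \<Rightarrow>\<^sub>L 'h) mat set \<Rightarrow> ('h \<Rightarrow>\<^sub>L 'h) mat set" where
  "tensor_closure S n C =
    {T \<in> tensor_space S n. \<forall>e>0. \<exists>U\<in>C. opmat_norm n (T - U) < e}"

section \<open>Positive, completely positive and decomposable maps\<close>

text \<open>
  Maps \<open>S \<rightarrow> M\<^sub>n\<close> are HOL functions whose values outside \<open>S\<close> are irrelevant.
\<close>

definition linear_map ::
    "('h::chilbert_space \<Rightarrow>\<^sub>L 'h) set \<Rightarrow> nat \<Rightarrow> (('h \<Rightarrow>\<^sub>L 'h) \<Rightarrow> complex mat) \<Rightarrow> bool" where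
  "linear_map S n \<phi> \<longleftrightarrow> (\<forall>s\<in>S. \<phi> s \<in> carrier_mat n n) \<and>
    (\<forall>s\<in>S. \<forall>t\<in>S. \<phi> (s + t) = \<phi> s + \<phi> t) \<and>
    (\<forall>c. \<forall>s\<in>S. \<phi> (scaleC_op c s) = c \<cdot>\<^sub>m \<phi> s)"

definition positive_map ::
    "('h::chilbert_space \<Rightarrow>\<^sub>L 'h) set \<Rightarrow> nat \<Rightarrow> (('h \<Rightarrow>\<^sub>L 'h) \<Rightarrow> complex mat) \<Rightarrow> bool" where
  "positive_map S n \<phi> \<longleftrightarrow> linear_map S n \<phi> \<and> (\<forall>s\<in>pos_part S. psd_mat n (\<phi> s))"

text \<open>
  \<open>M\<^sub>n \<otimes> M\<^sub>k = B(\<complex>\<^sup>n \<otimes> \<complex>\<^sup>k)\<close> is identified with the \<open>nk \<times> nk\<close> matrices by means of the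
  Kronecker product, i.e. \<open>e\<^sub>i \<otimes> e\<^sub>a\<close> is the basis vector with index \<open>i * k + a\<close>.
  The \<open>k\<close>-th amplification \<open>\<phi>\<^sub>k\<close> of \<open>\<phi>\<close> is written in terms of the entries of its argument;
  lemma \<open>ampl_tensor_sum\<close> is the defining property \<open>\<phi>\<^sub>k (s \<otimes> x) = \<phi> s \<otimes> x\<close>.
\<close>

definition kron :: "nat \<Rightarrow> nat \<Rightarrow> complex mat \<Rightarrow> complex mat \<Rightarrow> complex mat" where
  "kron n k X Y = mat (n * k) (n * k)
    (\<lambda>(p, q). X $$ (p div k, q div k) * Y $$ (p mod k, q mod k))"

definition ampl :: "nat \<Rightarrow> nat \<Rightarrow> (('h::chilbert_space \<Rightarrow>\<^sub>L 'h) \<Rightarrow> complex mat) \<Rightarrow>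
    ('h \<Rightarrow>\<^sub>L 'h) mat \<Rightarrow> complex mat" where
  "ampl n k \<phi> T = mat (n * k) (n * k)
    (\<lambda>(p, q). \<phi> (T $$ (p mod k, q mod k)) $$ (p div k, q div k))"

lemma linear_map_sum_entry:
  fixes S :: "('h::chilbert_space \<Rightarrow>\<^sub>L 'h) set" and m n :: nat
  assumes S: "csubspace_op S" and \<phi>: "linear_map S n \<phi>" and s: "\<And>j. j < m \<Longrightarrow> s j \<in> S"
    and ij: "i < n" "i' < n"
  shows "\<phi> (\<Sum>j<m. scaleC_op (c j) (s j)) $$ (i, i') = (\<Sum>j<m. c j * \<phi> (s j) $$ (i, i'))
    \<and> (\<Sum>j<m. scaleC_op (c j) (s j)) \<in> S"
  using s
proof (induction m)
  case 0
  have z: "0 \<in> S" using S by (simp add: csubspace_op_def)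
  have "scaleC_op 0 (0 :: 'h \<Rightarrow>\<^sub>L 'h) = 0"
    using scaleC_of_real[of 0 "_ :: 'h"] by (intro blinfun_eqI) (simp add: scaleC_op.rep_eq)
  then have "\<phi> 0 = 0 \<cdot>\<^sub>m \<phi> 0" and "\<phi> 0 \<in> carrier_mat n n"
    using \<phi> z unfolding linear_map_def by metis+
  then have "\<phi> 0 $$ (i, i') = 0"
    using ij by (metis carrier_matD index_smult_mat(1) mult_zero_left)
  then show ?case using z by simp
next
  case (Suc m)
  let ?t = "\<Sum>j<m. scaleC_op (c j) (s j)"
  have IH: "\<phi> ?t $$ (i, i') = (\<Sum>j<m. c j * \<phi> (s j) $$ (i, i'))" "?t \<in> S"
    using Suc by auto
  have sm: "s m \<in> S" "scaleC_op (c m) (s m) \<in> S"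
    using Suc.prems S by (auto simp: csubspace_op_def)
  have dims: "\<phi> (s m) \<in> carrier_mat n n" "\<phi> ?t \<in> carrier_mat n n"
    using \<phi> sm IH by (auto simp: linear_map_def)
  have "\<phi> (?t + scaleC_op (c m) (s m)) = \<phi> ?t + c m \<cdot>\<^sub>m \<phi> (s m)"
    using \<phi> sm IH by (auto simp: linear_map_def)
  moreover have "?t + scaleC_op (c m) (s m) \<in> S"
    using S sm IH by (auto simp: csubspace_op_def)
  ultimately show ?case using dims ij IH by auto
qed

lemma ampl_tensor_sum:
  fixes S :: "('h::chilbert_space \<Rightarrow>\<^sub>L 'h) set" and m n :: nat
  assumes S: "csubspace_op S" and \<phi>: "linear_map S n \<phi>" and s: "\<And>j. j < m \<Longrightarrow> s j \<in> S"
  shows "ampl n k \<phi> (tensor_sum k m s x) =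
    mat (n * k) (n * k) (\<lambda>pq. \<Sum>j<m. kron n k (\<phi> (s j)) (x j) $$ pq)"
proof (rule eq_matI)
  fix p q
  assume "p < dim_row (mat (n * k) (n * k) (\<lambda>pq. \<Sum>j<m. kron n k (\<phi> (s j)) (x j) $$ pq))"
    and "q < dim_col (mat (n * k) (n * k) (\<lambda>pq. \<Sum>j<m. kron n k (\<phi> (s j)) (x j) $$ pq))"
  then have pq: "p < n * k" "q < n * k" by auto
  then have "0 < k" by (cases k) auto
  with pq have "p mod k < k" "q mod k < k" "p div k < n" "q div k < n"
    by (auto simp: less_mult_imp_div_less)
  then show "ampl n k \<phi> (tensor_sum k m s x) $$ (p, q) =
    mat (n * k) (n * k) (\<lambda>pq. \<Sum>j<m. kron n k (\<phi> (s j)) (x j) $$ pq) $$ (p, q)"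
    using pq linear_map_sum_entry[OF S \<phi> s, where i = "p div k" and i' = "q div k"]
    by (simp add: ampl_def tensor_sum_def kron_def mult.commute)
qed (auto simp: ampl_def)

definition cp_map ::
    "('h::chilbert_space \<Rightarrow>\<^sub>L 'h) set \<Rightarrow> nat \<Rightarrow> (('h \<Rightarrow>\<^sub>L 'h) \<Rightarrow> complex mat) \<Rightarrow> bool" where
  "cp_map S n \<phi> \<longleftrightarrow> linear_map S n \<phi> \<and>
    (\<forall>k. \<forall>T\<in>tensor_space S k. opmat_pos k T \<longrightarrow> psd_mat (n * k) (ampl n k \<phi> T))"

definition cocp_map ::
    "('h::chilbert_space \<Rightarrow>\<^sub>L 'h) set \<Rightarrow> nat \<Rightarrow> (('h \<Rightarrow>\<^sub>L 'h) \<Rightarrow> complex mat) \<Rightarrow> bool" where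
  "cocp_map S n \<phi> \<longleftrightarrow> linear_map S n \<phi> \<and> cp_map S n (\<lambda>s. transpose_mat (\<phi> s))"

definition decomposable ::
    "('h::chilbert_space \<Rightarrow>\<^sub>L 'h) set \<Rightarrow> nat \<Rightarrow> (('h \<Rightarrow>\<^sub>L 'h) \<Rightarrow> complex mat) \<Rightarrow> bool" where
  "decomposable S n \<psi> \<longleftrightarrow> (\<exists>\<phi>\<^sub>1 \<phi>\<^sub>2. cp_map S n \<phi>\<^sub>1 \<and> cocp_map S n \<phi>\<^sub>2 \<and>
    (\<forall>s\<in>S. \<psi> s = \<phi>\<^sub>1 s + \<phi>\<^sub>2 s))"

end

theory Submission
  imports Defs "HOL-Library.Function_Algebras"
begin

text \<open>
  A linear map \<open>\<psi> : S \<rightarrow> M\<^sub>n\<close> is the same as the linear functional \<open>f T = \<Sum>\<^sub>a\<^sub>b \<psi>(T\<^sub>a\<^sub>b)\<^sub>a\<^sub>b\<close> on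
  \<open>S \<otimes> M\<^sub>n\<close> (\<open>pairing\<close> below).  Then \<open>\<psi>\<close> is positive iff \<open>f \<ge> 0\<close> on the cone \<open>S\<^sup>+ \<otimes> M\<^sub>n\<^sup>+\<close>, it is
  cp iff \<open>f \<ge> 0\<close> on the positive elements \<open>P\<close>, and co-cp iff \<open>f \<ge> 0\<close> on the partial transposes
  \<open>\<Gamma>P\<close>; moreover \<open>J\<^sub>n(S) = P \<inter> \<Gamma>P\<close>.  So a point of \<open>J\<^sub>n(S)\<close> outside the closed cone is separated
  from it by a positive map, which is not decomposable; conversely a functional that is nonnegative
  on \<open>P \<inter> \<Gamma>P\<close> is, by Hahn-Banach and because the unit is interior to both cones, a sum of one that
  is nonnegative on \<open>P\<close> and one that is nonnegative on \<open>\<Gamma>P\<close>.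
\<close>

section \<open>The Hahn-Banach theorem\<close>

text \<open>Hahn-Banach is never applied to \<open>S \<otimes> M_n\<close> itself. Blocks are
  functions on index pairs with values in all bounded real linear operators; pointwise operations
  make them one real vector space without dimension side conditions, and the functionals are built
  on the whole of it. Extension from a subspace is thereby avoided: the geometry of the cones is put
  into a relation \<open>R x r\<close>, read as: r is an admissible upper bound at x. Its infimum is
  sublinear, and a linear functional below it suffices. The real work is a lower bound for these
  infima. Two obstacles shape the rest. The functional is only real linear, whereas maps into
  \<open>M_n\<close> are complex linear; the bounds are therefore formulated through real parts of
  quadratic forms, so that the functional vanishes on blocks whose form is purely imaginary and its
  complexification is real on Hermitian blocks. And the closure is taken in operator norm, so
  positive maps must be shown bounded, and numerical bounds on Hermitian blocks must be turned into
  norm bounds.\<close>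

instantiation "fun" :: (type, real_vector) real_vector
begin

definition scaleR_fun :: "real \<Rightarrow> ('a \<Rightarrow> 'b) \<Rightarrow> 'a \<Rightarrow> 'b" where
  "scaleR_fun r f = (\<lambda>x. r *\<^sub>R f x)"

instance
  by intro_classes
    (auto simp: scaleR_fun_def scaleR_add_right scaleR_add_left plus_fun_def)

end

lemma scaleR_fun_apply [simp]: "(r *\<^sub>R f) x = r *\<^sub>R f x"
  by (simp add: scaleR_fun_def)

text \<open>The inequality in the scaling clause already gives equality, by using it for c and for
  1/c; in this weak form it passes directly to infima.\<close>

definition sublinear :: "('a::real_vector \<Rightarrow> real) \<Rightarrow> bool" where
  "sublinear p \<longleftrightarrow> (\<forall>x y. p (x + y) \<le> p x + p y) \<and> (\<forall>c>0. \<forall>x. p (c *\<^sub>R x) \<le> c * p x)"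

lemma sublinear_zero:
  assumes "sublinear p"
  shows "p 0 = 0"
proof (rule antisym)
  have "p ((1/2) *\<^sub>R 0) \<le> (1/2) * p 0"
    using assms[unfolded sublinear_def, THEN conjunct2, rule_format, of "1/2" 0] by simp
  then show "p 0 \<le> 0" by simp
  have "p (0 + 0) \<le> p 0 + p 0"
    using assms unfolding sublinear_def by blast
  then show "0 \<le> p 0" by simp
qed

lemma sublinear_minus:
  assumes "sublinear p"
  shows "- p (- x) \<le> p x"
proof -
  have "p (x + - x) \<le> p x + p (- x)"
    using assms unfolding sublinear_def by blast
  then show ?thesis using sublinear_zero[OF assms] by simp
qed

lemma Inf_relation_le:
  fixes R :: "'a \<Rightarrow> real \<Rightarrow> bool"
  assumes "\<exists>b. \<forall>r. R x r \<longrightarrow> b \<le> r" and "R x r"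
  shows "Inf {r. R x r} \<le> r"
  using assms by (intro cInf_lower) (auto simp: bdd_below_def)

text \<open>\<open>R x r\<close> reads as: r is an admissible value at x. The witness u may lie
  strictly below r + s because, for a chain of functionals or for a subadditive m, adding admissible
  values only yields an upper bound for an admissible value of the sum.\<close>

lemma sublinear_Inf:
  fixes R :: "'a::real_vector \<Rightarrow> real \<Rightarrow> bool"
  assumes add: "\<And>x y r s. R x r \<Longrightarrow> R y s \<Longrightarrow> \<exists>u\<le>r + s. R (x + y) u"
    and scale: "\<And>x r c. R x r \<Longrightarrow> 0 < c \<Longrightarrow> R (c *\<^sub>R x) (c * r)"
    and ex: "\<And>x. \<exists>r. R x r"
    and bdd: "\<And>x. \<exists>b. \<forall>r. R x r \<longrightarrow> b \<le> r"
  shows "sublinear (\<lambda>x. Inf {r. R x r})"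
proof -
  have le: "Inf {r. R x r} \<le> r" if "R x r" for x r
    using that by (rule Inf_relation_le[OF bdd])
  have approx: "\<exists>r. R x r \<and> r < Inf {r. R x r} + e" if "0 < e" for x e
    using ex[of x] cInf_lessD[of "{r. R x r}" "Inf {r. R x r} + e"] that by auto
  show "sublinear (\<lambda>x. Inf {r. R x r})"
    unfolding sublinear_def
  proof (intro conjI allI impI)
    fix x y
    show "Inf {r. R (x + y) r} \<le> Inf {r. R x r} + Inf {r. R y r}"
    proof (rule field_le_epsilon)
      fix e :: real assume e: "0 < e"
      obtain r where r: "R x r" "r < Inf {r. R x r} + e / 2"
        using approx[of "e / 2" x] e by auto
      obtain s where s: "R y s" "s < Inf {r. R y r} + e / 2"
        using approx[of "e / 2" y] e by auto
      obtain u where u: "u \<le> r + s" "R (x + y) u"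
        using add[OF r(1) s(1)] by auto
      show "Inf {r. R (x + y) r} \<le> Inf {r. R x r} + Inf {r. R y r} + e"
        using le[OF u(2)] u(1) r s by (simp add: field_simps)
    qed
  next
    fix c :: real and x assume c: "0 < c"
    show "Inf {r. R (c *\<^sub>R x) r} \<le> c * Inf {r. R x r}"
    proof (rule field_le_epsilon)
      fix e :: real assume e: "0 < e"
      obtain r where r: "R x r" "r < Inf {r. R x r} + e / c"
        using approx[of "e / c" x] e c by auto
      have "c * r < c * (Inf {r. R x r} + e / c)" using r c by simp
      also have "\<dots> = c * Inf {r. R x r} + e" using c by (simp add: field_simps)
      finally show "Inf {r. R (c *\<^sub>R x) r} \<le> c * Inf {r. R x r} + e"
        using le[OF scale[OF r(1) c]] by linarith
    qed
  qed
qed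

text \<open>For fixed y, the infimum over t \<ge> 0 of m (x + t y) - t m y is sublinear and lies
  below m (take t = 0), so minimality makes it equal to m; the value t = 1 then gives
  superadditivity in the direction y.\<close>

lemma minimal_sublinear_linear:
  assumes m: "sublinear m"
    and min: "\<And>q. sublinear q \<Longrightarrow> \<forall>x. q x \<le> m x \<Longrightarrow> q = m"
  shows "linear m"
proof -
  have sub: "m (x + y) \<le> m x + m y" for x y using m unfolding sublinear_def by blast
  have hom_le: "m (c *\<^sub>R x) \<le> c * m x" if "0 < c" for c x using m that unfolding sublinear_def by blast
  have hom: "m (c *\<^sub>R x) = c * m x" if "0 < c" for c x
  proof (rule antisym)
    have "m ((1 / c) *\<^sub>R (c *\<^sub>R x)) \<le> (1 / c) * m (c *\<^sub>R x)"
      using that by (intro hom_le) auto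
    then show "c * m x \<le> m (c *\<^sub>R x)" using that by (simp add: field_simps)
  qed (use hom_le that in auto)
  have super: "m x + m y \<le> m (x + y)" for x y
  proof -
    define R where "R = (\<lambda>x r. \<exists>t\<ge>0. r = m (x + t *\<^sub>R y) - t * m y)"
    have add: "\<exists>u\<le>r + s. R (x1 + x2) u" if "R x1 r" "R x2 s" for x1 x2 r s
    proof -
      obtain t1 t2 where t: "0 \<le> t1" "r = m (x1 + t1 *\<^sub>R y) - t1 * m y"
        "0 \<le> t2" "s = m (x2 + t2 *\<^sub>R y) - t2 * m y"
        using \<open>R x1 r\<close> \<open>R x2 s\<close> unfolding R_def by auto
      have "m ((x1 + x2) + (t1 + t2) *\<^sub>R y) \<le> m (x1 + t1 *\<^sub>R y) + m (x2 + t2 *\<^sub>R y)"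
        using sub[of "x1 + t1 *\<^sub>R y" "x2 + t2 *\<^sub>R y"] by (simp add: algebra_simps)
      then show ?thesis
        using t unfolding R_def
        by (intro exI[of _ "m ((x1 + x2) + (t1 + t2) *\<^sub>R y) - (t1 + t2) * m y"])
          (auto simp: algebra_simps intro!: exI[of _ "t1 + t2"])
    qed
    have scale: "R (c *\<^sub>R x) (c * r)" if Rx: "R x r" and c: "0 < c" for x r c
    proof -
      obtain t where t: "0 \<le> t" "r = m (x + t *\<^sub>R y) - t * m y" using Rx unfolding R_def by auto
      have "c * r = m (c *\<^sub>R x + (c * t) *\<^sub>R y) - (c * t) * m y"
        using hom[OF c, of "x + t *\<^sub>R y"]
        by (simp add: t(2) scaleR_add_right right_diff_distrib mult.assoc)
      then show ?thesis using t c unfolding R_def by (auto intro!: exI[of _ "c * t"])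
    qed
    have ex: "\<exists>r. R x r" for x unfolding R_def by (auto intro: exI[of _ 0])
    have bdd: "\<exists>b. \<forall>r. R x r \<longrightarrow> b \<le> r" for x
    proof (intro exI allI impI)
      fix r assume "R x r"
      then obtain t where t: "0 \<le> t" "r = m (x + t *\<^sub>R y) - t * m y" unfolding R_def by auto
      have "t * m y = m (t *\<^sub>R y)"
        using t(1) hom[of t y] sublinear_zero[OF m] by (cases "t = 0") auto
      \<comment> \<open>Since t y = (x + t y) + (- x), every admissible value is at least - m (- x),
        independently of t.\<close>
      also have "\<dots> \<le> m (x + t *\<^sub>R y) + m (- x)" using sub[of "x + t *\<^sub>R y" "- x"] by simp
      finally show "- m (- x) \<le> r" using t by simp
    qed
    have inf: "sublinear (\<lambda>x. Inf {r. R x r})" "\<And>x r. R x r \<Longrightarrow> Inf {r. R x r} \<le> r"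
      by (rule sublinear_Inf[of R]; fact add scale ex bdd) (rule Inf_relation_le[OF bdd])
    have "(\<lambda>x. Inf {r. R x r}) = m"
    proof (rule min)
      show "\<forall>x. Inf {r. R x r} \<le> m x"
      proof
        fix x
        have "R x (m x)" unfolding R_def by (auto intro!: exI[of _ 0])
        then show "Inf {r. R x r} \<le> m x" by (rule inf(2))
      qed
    qed (rule inf(1))
    moreover have "R x (m (x + y) - m y)" unfolding R_def by (auto intro!: exI[of _ 1])
    ultimately have "m x \<le> m (x + y) - m y" using inf(2) by metis
    then show ?thesis by simp
  qed
  have add: "m (x + y) = m x + m y" for x y using sub super by (intro antisym)
  have neg: "m (- x) = - m x" for x
    using add[of x "- x"] sublinear_zero[OF m] by simp
  show ?thesis
  proof (rule linearI)
    fix r x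
    show "m (r *\<^sub>R x) = r *\<^sub>R m x"
    proof (cases r "0 :: real" rule: linorder_cases)
      case less
      have "m (- ((- r) *\<^sub>R x)) = - ((- r) * m x)"
        using less hom[of "- r" x] by (simp only: neg)
      then show ?thesis by simp
    qed (use hom sublinear_zero[OF m] in auto)
  qed (rule add)
qed

text \<open>Zorn's lemma on the sublinear functionals below p, looking for a minimal one. A nonempty
  chain is bounded by its pointwise infimum, which is finite because q x \<ge> - q (- x) \<ge> - p
  (- x) for each member q.\<close>

lemma sublinear_dominates_linear:
  fixes p :: "'a::real_vector \<Rightarrow> real"
  assumes p: "sublinear p"
  obtains f where "linear f" "\<And>x. f x \<le> p x"
proof -
  define X where "X = {q. sublinear q \<and> (\<forall>x. q x \<le> p x)}"
  \<comment> \<open>The order is reversed: maximal for \<open>P\<close> means pointwise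
    minimal.\<close>
  define P where "P = (\<lambda>q r :: 'a \<Rightarrow> real. \<forall>x. r x \<le> q x)"
  have "\<exists>m\<in>X. \<forall>a\<in>X. P m a \<longrightarrow> a = m"
  proof (rule predicate_Zorn)
    show "partial_order_on X (relation_of P X)"
      by (rule partial_order_on_relation_ofI)
        (auto simp: P_def fun_eq_iff intro: order_trans antisym)
    fix C assume "C \<in> Chains (relation_of P X)"
    then have C: "C \<subseteq> X" and tot: "\<And>a b. a \<in> C \<Longrightarrow> b \<in> C \<Longrightarrow> P a b \<or> P b a"
      unfolding Chains_def relation_of_def by auto
    show "\<exists>u\<in>X. \<forall>a\<in>C. P a u"
    proof (cases "C = {}")
      case True
      then show ?thesis using p unfolding X_def by auto
    next
      case False
      define R where "R = (\<lambda>x r. \<exists>q\<in>C. r = q x)"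
      have add: "\<exists>u\<le>r + s. R (x + y) u" if "R x r" "R y s" for x y r s
      proof -
        obtain q1 q2 where q: "q1 \<in> C" "r = q1 x" "q2 \<in> C" "s = q2 y"
          using \<open>R x r\<close> \<open>R y s\<close> unfolding R_def by auto
        then have "sublinear q1" "sublinear q2" using C unfolding X_def by auto
        then have s: "q1 (x + y) \<le> q1 x + q1 y" "q2 (x + y) \<le> q2 x + q2 y"
          unfolding sublinear_def by auto
        \<comment> \<open>Whichever of the two functionals is the smaller one supplies the witness
          at x + y.\<close>
        from tot[OF q(1,3)] show ?thesis
        proof
          assume "P q1 q2"
          then have "q2 x \<le> q1 x" unfolding P_def by auto
          then have "q2 (x + y) \<le> r + s" using s(2) q by linarith
          then show ?thesis using q unfolding R_def by auto
        next
          assume "P q2 q1"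
          then have "q1 y \<le> q2 y" unfolding P_def by auto
          then have "q1 (x + y) \<le> r + s" using s(1) q by linarith
          then show ?thesis using q unfolding R_def by auto
        qed
      qed
      have scale: "R (c *\<^sub>R x) (c * r)" if Rx: "R x r" and c: "0 < c" for x r c
      proof -
        obtain q where q: "q \<in> C" "r = q x" using Rx unfolding R_def by auto
        then have s: "sublinear q" using C unfolding X_def by auto
        have "q ((1 / c) *\<^sub>R (c *\<^sub>R x)) \<le> (1 / c) * q (c *\<^sub>R x)"
          using s c unfolding sublinear_def by (meson zero_less_divide_1_iff)
        then have "c * q x \<le> q (c *\<^sub>R x)" using c by (simp add: field_simps)
        moreover have "q (c *\<^sub>R x) \<le> c * q x" using s c unfolding sublinear_def by blast
        ultimately show ?thesis using q unfolding R_def by (metis antisym)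
      qed
      have ex: "\<exists>r. R x r" for x using False unfolding R_def by auto
      have bdd: "\<exists>b. \<forall>r. R x r \<longrightarrow> b \<le> r" for x
      proof (intro exI allI impI)
        fix r assume "R x r"
        then obtain q where q: "q \<in> C" "r = q x" unfolding R_def by auto
        then have "sublinear q" "q (- x) \<le> p (- x)" using C unfolding X_def by auto
        then show "- p (- x) \<le> r" using sublinear_minus[of q x] q by linarith
      qed
      have inf: "sublinear (\<lambda>x. Inf {r. R x r})" "\<And>x r. R x r \<Longrightarrow> Inf {r. R x r} \<le> r"
        by (rule sublinear_Inf[of R]; fact add scale ex bdd) (rule Inf_relation_le[OF bdd])
      have le: "Inf {r. R x r} \<le> q x" if "q \<in> C" for q x
        by (rule inf(2)) (use that R_def in auto)
      have "(\<lambda>x. Inf {r. R x r}) \<in> X"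
      proof -
        obtain q where "q \<in> C" using False by auto
        then have "Inf {r. R x r} \<le> p x" for x
          using le[of q x] C unfolding X_def by (auto intro: order_trans)
        then show ?thesis using inf(1) unfolding X_def by auto
      qed
      then show ?thesis using le unfolding P_def by (intro bexI[of _ "\<lambda>x. Inf {r. R x r}"]) auto
    qed
  qed
  then obtain m where m: "m \<in> X" and min: "\<And>a. a \<in> X \<Longrightarrow> P m a \<Longrightarrow> a = m" by auto
  have "linear m"
  proof (rule minimal_sublinear_linear)
    show "sublinear m" using m X_def by auto
    fix q assume "sublinear q" "\<forall>x. q x \<le> m x"
    then show "q = m" using m unfolding X_def P_def
      by (intro min) (auto simp: X_def P_def intro: order_trans)
  qed
  then show ?thesis using that m X_def by auto
qed

text \<open>The first two hypotheses make the admissible pairs a convex cone up to lowering r; the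
  last two make the infimum finite. The bound from below is where each application has to use its
  geometry.\<close>

lemma Hahn_Banach_relation:
  fixes R :: "'a::real_vector \<Rightarrow> real \<Rightarrow> bool"
  assumes "\<And>x y r s. R x r \<Longrightarrow> R y s \<Longrightarrow> \<exists>u\<le>r + s. R (x + y) u"
    and "\<And>x r c. R x r \<Longrightarrow> 0 < c \<Longrightarrow> R (c *\<^sub>R x) (c * r)"
    and "\<And>x. \<exists>r. R x r"
    and "\<And>x. \<exists>b. \<forall>r. R x r \<longrightarrow> b \<le> r"
  obtains f where "linear f" "\<And>x r. R x r \<Longrightarrow> f x \<le> r"
proof -
  have inf: "sublinear (\<lambda>x. Inf {r. R x r})" "\<And>x r. R x r \<Longrightarrow> Inf {r. R x r} \<le> r"
    by (rule sublinear_Inf[of R]; fact assms) (rule Inf_relation_le[OF assms(4)])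
  obtain f where "linear f" "\<And>x. f x \<le> Inf {r. R x r}"
    using sublinear_dominates_linear[OF inf(1)] by blast
  then show ?thesis using that inf(2) by (meson order_trans)
qed

section \<open>Operator matrices as sesquilinear forms\<close>

lemma cinner_add_left: "cinner (x + y) z = cinner x z + cinner y z"
  for x :: "'h::chilbert_space"
  by (metis cinner_add_right cinner_commute complex_cnj_add)

lemma cinner_zero_left [simp]: "cinner 0 x = 0" for x :: "'h::chilbert_space"
  using cinner_add_left[of 0 0 x] by simp

lemma cinner_zero_right [simp]: "cinner x 0 = 0" for x :: "'h::chilbert_space"
  using cinner_add_right[of x 0 0] by simp

lemma cinner_sum_left: "cinner (sum f A) y = (\<Sum>i\<in>A. cinner (f i) y)"
  for y :: "'h::chilbert_space"
  by (induction A rule: infinite_finite_induct) (auto simp: cinner_add_left)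

lemma cinner_sum_right: "cinner y (sum f A) = (\<Sum>i\<in>A. cinner y (f i))"
  for y :: "'h::chilbert_space"
  by (induction A rule: infinite_finite_induct) (auto simp: cinner_add_right)

lemma cinner_scaleR_right: "cinner x (r *\<^sub>R y) = complex_of_real r * cinner x y"
  for x :: "'h::chilbert_space"
  by (metis cinner_scaleC_right scaleC_of_real)

lemma Re_cinner_le: "\<bar>Re (cinner x y)\<bar> \<le> norm x * norm y" for x :: "'h::chilbert_space"
  using Cauchy_Schwarz_ineq2[of x y] by (simp add: inner_eq_Re_cinner)

lemma scaleC_zero_left [simp]: "0 *\<^sub>C x = 0" for x :: "'h::chilbert_space"
  using scaleC_of_real[of 0 x] by simp

lemma scaleC_zero_right [simp]: "c *\<^sub>C 0 = 0" for c :: complex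
  by (rule linear_0[OF bounded_linear.linear[OF bounded_linear_scaleC]])

lemma scaleC_op_apply [simp]: "blinfun_apply (scaleC_op c T) x = c *\<^sub>C blinfun_apply T x"
  by (simp add: scaleC_op.rep_eq)

lemma scaleC_op_zero_left [simp]: "scaleC_op 0 T = 0"
  by (rule blinfun_eqI) simp

lemma scaleC_op_zero_right [simp]: "scaleC_op c 0 = 0"
  by (rule blinfun_eqI) simp

lemma scaleC_op_of_real: "scaleC_op (complex_of_real r) T = r *\<^sub>R T"
  by (rule blinfun_eqI) (simp add: scaleC_of_real blinfun.scaleR_left)

lemma scaleC_op_add_right: "scaleC_op c (T + U) = scaleC_op c T + scaleC_op c U"
  by (rule blinfun_eqI) (simp add: scaleC_add_right blinfun.add_left)

lemma scaleC_op_add_left: "scaleC_op (c + d) T = scaleC_op c T + scaleC_op d T"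
  by (rule blinfun_eqI) (simp add: scaleC_add_left blinfun.add_left)

lemma scaleC_op_scaleC_op: "scaleC_op c (scaleC_op d T) = scaleC_op (c * d) T"
  by (rule blinfun_eqI) (simp add: scaleC_scaleC)

lemma norm_scaleC_op: "norm (scaleC_op c T) \<le> cmod c * norm T"
  by (rule norm_blinfun_bound)
    (auto simp: norm_scaleC mult.assoc intro!: mult_left_mono norm_blinfun)

lemma BH_apply: "T \<in> BH \<Longrightarrow> blinfun_apply T (c *\<^sub>C x) = c *\<^sub>C blinfun_apply T x"
  by (simp add: BH_def)

text \<open>Blocks and vectors are plain functions instead of \<open>mat\<close> and
  \<open>vec\<close>, so they carry addition and scaling without carrier conditions; entries with an
  index \<ge> n are ignored.\<close>

definition qform :: "nat \<Rightarrow> (nat \<times> nat \<Rightarrow> 'h::chilbert_space \<Rightarrow>\<^sub>L 'h) \<Rightarrow> (nat \<Rightarrow> 'h) \<Rightarrow> (nat \<Rightarrow> 'h) \<Rightarrow> complex"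
  where "qform n Z g h = (\<Sum>a<n. \<Sum>b<n. cinner (g a) (blinfun_apply (Z (a, b)) (h b)))"

definition sqnorm :: "nat \<Rightarrow> (nat \<Rightarrow> 'h::chilbert_space) \<Rightarrow> real"
  where "sqnorm n h = (\<Sum>a<n. (norm (h a))\<^sup>2)"

definition form_pos :: "nat \<Rightarrow> (nat \<times> nat \<Rightarrow> 'h::chilbert_space \<Rightarrow>\<^sub>L 'h) \<Rightarrow> bool"
  where "form_pos n Z \<longleftrightarrow> (\<forall>h. 0 \<le> qform n Z h h)"

text \<open>A numerical radius bound on the Hermitian part: it does not constrain blocks whose form
  is purely imaginary. For complex linear blocks with real form it becomes a bound on the norm in
  \<open>opmat_norm_le\<close>.\<close>

definition form_bounded :: "nat \<Rightarrow> real \<Rightarrow> (nat \<times> nat \<Rightarrow> 'h::chilbert_space \<Rightarrow>\<^sub>L 'h) \<Rightarrow> bool"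
  where "form_bounded n r Z \<longleftrightarrow> (\<forall>h. \<bar>Re (qform n Z h h)\<bar> \<le> r * sqnorm n h)"

definition entries_in :: "'s set \<Rightarrow> nat \<Rightarrow> (nat \<times> nat \<Rightarrow> 's) \<Rightarrow> bool"
  where "entries_in S n Z \<longleftrightarrow> (\<forall>a<n. \<forall>b<n. Z (a, b) \<in> S)"

definition unit_block :: "nat \<times> nat \<Rightarrow> 'h::chilbert_space \<Rightarrow>\<^sub>L 'h"
  where "unit_block = (\<lambda>(a, b). if a = b then id_blinfun else 0)"

lemma qform_cong:
  "(\<And>a b. a < n \<Longrightarrow> b < n \<Longrightarrow> Y (a, b) = Z (a, b)) \<Longrightarrow> qform n Y g h = qform n Z g h"
  by (simp add: qform_def)

lemma qform_add_left: "qform n Z (\<lambda>a. g a + g' a) h = qform n Z g h + qform n Z g' h"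
  by (simp add: qform_def cinner_add_left sum.distrib)

lemma qform_add_right: "qform n Z g (\<lambda>a. h a + h' a) = qform n Z g h + qform n Z g h'"
  by (simp add: qform_def cinner_add_right blinfun.add_right sum.distrib)

lemma qform_scaleC_left: "qform n Z (\<lambda>a. c *\<^sub>C g a) h = cnj c * qform n Z g h"
  by (simp add: qform_def cinner_scaleC_left sum_distrib_left)

lemma qform_scaleC_right:
  assumes "entries_in BH n Z"
  shows "qform n Z g (\<lambda>a. c *\<^sub>C h a) = c * qform n Z g h"
  using assms
  by (simp add: qform_def entries_in_def BH_apply cinner_scaleC_right sum_distrib_left)

text \<open>Vectors supported on one coordinate recover the matrix elements, so identities between
  forms become identities between entries.\<close>

lemma qform_delta:
  assumes "a < n" "b < n"
  shows "qform n Z (\<lambda>i. if i = a then x else 0) (\<lambda>j. if j = b then y else 0) =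
    cinner x (blinfun_apply (Z (a, b)) y)"
proof -
  have "cinner (if i = a then x else 0) (blinfun_apply (Z (i, j)) (if j = b then y else 0)) =
    (if i = a then if j = b then cinner x (blinfun_apply (Z (a, b)) y) else 0 else 0)" for i j
    by simp
  then have "qform n Z (\<lambda>i. if i = a then x else 0) (\<lambda>j. if j = b then y else 0) =
    (\<Sum>i<n. \<Sum>j<n. (if i = a then if j = b then cinner x (blinfun_apply (Z (a, b)) y) else 0 else 0))"
    unfolding qform_def by simp
  also have "\<dots> = (\<Sum>i<n. if i = a then cinner x (blinfun_apply (Z (a, b)) y) else 0)"
    using assms by (intro sum.cong) (auto simp: sum.delta)
  finally show ?thesis using assms by (simp add: sum.delta)
qed

lemma qform_plus: "qform n (Y + Z) g h = qform n Y g h + qform n Z g h"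
  by (simp add: qform_def blinfun.add_left cinner_add_right sum.distrib)

lemma qform_scaleR: "qform n (r *\<^sub>R Z) g h = complex_of_real r * qform n Z g h"
  by (simp add: qform_def blinfun.scaleR_left cinner_scaleR_right sum_distrib_left)

lemma qform_uminus: "qform n (- Z) g h = - qform n Z g h"
  using qform_scaleR[of n "-1" Z g h] by simp

lemma qform_minus: "qform n (Y - Z) g h = qform n Y g h - qform n Z g h"
  using qform_plus[of n Y "- Z" g h] by (simp add: qform_uminus)

lemma qform_zero [simp]: "qform n 0 g h = 0"
  by (simp add: qform_def)

lemma qform_scaleC_op: "qform n (\<lambda>p. scaleC_op c (Z p)) g h = c * qform n Z g h"
  by (simp add: qform_def cinner_scaleC_right sum_distrib_left)

lemma qform_unit_block: "qform n unit_block h h = complex_of_real (sqnorm n h)"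
proof -
  have "qform n unit_block h h = (\<Sum>a<n. \<Sum>b<n. if b = a then cinner (h a) (h a) else 0)"
    unfolding qform_def by (intro sum.cong) (auto simp: unit_block_def)
  also have "\<dots> = complex_of_real (sqnorm n h)"
    by (simp add: sum.delta sqnorm_def cinner_self)
  finally show ?thesis .
qed

lemma sqnorm_nonneg [simp]: "0 \<le> sqnorm n h"
  by (simp add: sqnorm_def sum_nonneg)

lemma norm_le_sqnorm: "a < n \<Longrightarrow> (norm (h a))\<^sup>2 \<le> sqnorm n h"
  unfolding sqnorm_def by (rule member_le_sum) auto

text \<open>Makes \<open>unit_block\<close> an order unit. With k the sum of the norms of the
  entries, each term is controlled by 2 |h_a| |h_b| \<le> |h_a|^2 + |h_b|^2, which is at most twice
  \<open>sqnorm n h\<close>.\<close>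

lemma form_bounded_exists: "\<exists>k\<ge>0. form_bounded n k Z"
proof -
  define k where "k = (\<Sum>a<n. \<Sum>b<n. norm (Z (a, b)))"
  have "\<bar>Re (qform n Z h h)\<bar> \<le> k * sqnorm n h" for h
  proof -
    have "\<bar>Re (cinner (h a) (blinfun_apply (Z (a, b)) (h b)))\<bar> \<le> norm (Z (a, b)) * sqnorm n h"
      if "a < n" "b < n" for a b
    proof -
      have "2 * (norm (h a) * norm (h b)) \<le> (norm (h a))\<^sup>2 + (norm (h b))\<^sup>2"
        using sum_squares_bound[of "norm (h a)" "norm (h b)"] by simp
      then have ab: "norm (h a) * norm (h b) \<le> sqnorm n h"
        using norm_le_sqnorm[of a n h] norm_le_sqnorm[of b n h] that by linarith
      have "\<bar>Re (cinner (h a) (blinfun_apply (Z (a, b)) (h b)))\<bar> \<le> norm (h a) * norm (blinfun_apply (Z (a, b)) (h b))"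
        by (rule Re_cinner_le)
      also have "\<dots> \<le> norm (h a) * (norm (Z (a, b)) * norm (h b))"
        by (intro mult_left_mono norm_blinfun) auto
      also have "\<dots> = norm (Z (a, b)) * (norm (h a) * norm (h b))" by simp
      also have "\<dots> \<le> norm (Z (a, b)) * sqnorm n h"
        by (intro mult_left_mono ab) auto
      finally show ?thesis .
    qed
    then have "(\<Sum>a<n. \<Sum>b<n. \<bar>Re (cinner (h a) (blinfun_apply (Z (a, b)) (h b)))\<bar>) \<le>
      (\<Sum>a<n. \<Sum>b<n. norm (Z (a, b)) * sqnorm n h)"
      by (intro sum_mono) auto
    moreover have "\<bar>Re (qform n Z h h)\<bar> \<le>
      (\<Sum>a<n. \<Sum>b<n. \<bar>Re (cinner (h a) (blinfun_apply (Z (a, b)) (h b)))\<bar>)"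
      unfolding qform_def Re_sum by (intro order_trans[OF sum_abs] sum_mono sum_abs)
    ultimately show ?thesis unfolding k_def by (simp add: sum_distrib_right)
  qed
  moreover have "0 \<le> k" unfolding k_def by (simp add: sum_nonneg)
  ultimately show ?thesis unfolding form_bounded_def by auto
qed

lemma form_pos_unit_block: "form_pos n unit_block"
  by (simp add: form_pos_def qform_unit_block less_eq_complex_def)

lemma form_pos_cong:
  "(\<And>a b. a < n \<Longrightarrow> b < n \<Longrightarrow> Y (a, b) = Z (a, b)) \<Longrightarrow> form_pos n Y \<longleftrightarrow> form_pos n Z"
  unfolding form_pos_def using qform_cong[of n Y Z] by simp

lemma form_pos_plus: "form_pos n Y \<Longrightarrow> form_pos n Z \<Longrightarrow> form_pos n (Y + Z)"
  by (simp add: form_pos_def qform_plus)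

lemma form_pos_scaleR: "form_pos n Z \<Longrightarrow> 0 \<le> r \<Longrightarrow> form_pos n (r *\<^sub>R Z)"
  by (simp add: form_pos_def qform_scaleR less_eq_complex_def)

text \<open>Polarization: the real diagonal values at g + h give the imaginary part of the claim,
  those at g + i h the real part; complex linearity of the entries is what allows i to be taken
  out.\<close>

lemma form_real_hermitian:
  assumes Z: "entries_in BH n Z" and real: "\<And>h. Im (qform n Z h h) = 0"
  shows "qform n Z g h = cnj (qform n Z h g)"
proof -
  have "Im (qform n Z g h + qform n Z h g) = 0"
    using real[of "\<lambda>a. g a + h a"] real[of g] real[of h]
    by (simp add: qform_add_left qform_add_right)
  moreover have "Re (qform n Z g h - qform n Z h g) = 0"
    using real[of "\<lambda>a. g a + \<i> *\<^sub>C h a"] real[of g] real[of h]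
    by (simp add: qform_add_left qform_add_right qform_scaleC_left qform_scaleC_right[OF Z])
  ultimately show ?thesis by (simp add: complex_eq_iff)
qed

text \<open>A real form means that entry (b, a) is the adjoint of entry (a, b), a condition that
  survives exchanging the two indices. So the partial transpose of a Hermitian block is Hermitian,
  though positivity may be lost.\<close>

lemma form_real_swap:
  assumes Z: "entries_in BH n Z" and real: "\<And>h. Im (qform n Z h h) = 0"
  shows "Im (qform n (\<lambda>(a, b). Z (b, a)) h h) = 0"
proof -
  have ent: "cinner x (blinfun_apply (Z (b, a)) y) = cnj (cinner y (blinfun_apply (Z (a, b)) x))"
    if "a < n" "b < n" for a b x y
    using form_real_hermitian[OF Z real, of "\<lambda>i. if i = b then x else 0" "\<lambda>i. if i = a then y else 0"]
    by (simp only: qform_delta that)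
  have "qform n (\<lambda>(a, b). Z (b, a)) h h = cnj (\<Sum>a<n. \<Sum>b<n. cinner (h b) (blinfun_apply (Z (a, b)) (h a)))"
    unfolding qform_def cnj_sum by (intro sum.cong refl, simp only: prod.case) (rule ent; simp)
  also have "(\<Sum>a<n. \<Sum>b<n. cinner (h b) (blinfun_apply (Z (a, b)) (h a))) = qform n (\<lambda>(a, b). Z (b, a)) h h"
    unfolding qform_def by (subst sum.swap) simp
  finally show ?thesis by (simp add: complex_eq_iff)
qed

lemma form_pos_imp_real: "form_pos n Z \<Longrightarrow> Im (qform n Z h h) = 0"
  by (simp add: form_pos_def less_eq_complex_def)

text \<open>Polarization writes 4 Re of the form at (g, h) as the difference of its values at g + h
  and g - h; the parallelogram law then sums the two bounds.\<close>

lemma polarized_bound: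
  assumes Z: "entries_in BH n Z" and real: "\<And>h. Im (qform n Z h h) = 0"
    and r: "form_bounded n r Z"
  shows "2 * \<bar>Re (qform n Z g h)\<bar> \<le> r * (sqnorm n g + sqnorm n h)"
proof -
  have par: "sqnorm n (\<lambda>a. g a + h a) + sqnorm n (\<lambda>a. g a + (-1) *\<^sub>C h a) = 2 * (sqnorm n g + sqnorm n h)"
  proof -
    have "(norm (x + y))\<^sup>2 + (norm (x + (-1) *\<^sub>C y))\<^sup>2 = 2 * ((norm x)\<^sup>2 + (norm y)\<^sup>2)" for x y :: 'a
      using scaleC_of_real[of "-1" y]
      by (simp add: power2_norm_eq_inner algebra_simps inner_commute)
    then show ?thesis
      unfolding sqnorm_def sum.distrib[symmetric] sum_distrib_left by (intro sum.cong) auto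
  qed
  have "qform n Z g h = cnj (qform n Z h g)" by (rule form_real_hermitian[OF Z real])
  then have sym: "Re (qform n Z h g) = Re (qform n Z g h)" by simp
  have "4 * Re (qform n Z g h) = Re (qform n Z (\<lambda>a. g a + h a) (\<lambda>a. g a + h a)) -
    Re (qform n Z (\<lambda>a. g a + (-1) *\<^sub>C h a) (\<lambda>a. g a + (-1) *\<^sub>C h a))"
    by (simp add: qform_add_left qform_add_right qform_scaleC_left qform_scaleC_right[OF Z] sym)
  moreover have "\<bar>Re (qform n Z (\<lambda>a. g a + h a) (\<lambda>a. g a + h a))\<bar> \<le> r * sqnorm n (\<lambda>a. g a + h a)"
    "\<bar>Re (qform n Z (\<lambda>a. g a + (-1) *\<^sub>C h a) (\<lambda>a. g a + (-1) *\<^sub>C h a))\<bar> \<le> r * sqnorm n (\<lambda>a. g a + (-1) *\<^sub>C h a)"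
    using r unfolding form_bounded_def by blast+
  moreover have "r * (sqnorm n (\<lambda>a. g a + h a)) + r * sqnorm n (\<lambda>a. g a + (-1) *\<^sub>C h a) = 2 * (r * (sqnorm n g + sqnorm n h))"
    using par by (metis distrib_left mult.left_commute)
  ultimately show ?thesis by linarith
qed

lemma form_pos_Re: "form_pos n Z \<Longrightarrow> 0 \<le> Re (qform n Z h h)"
  by (simp add: form_pos_def less_eq_complex_def)

lemma form_Cauchy_Schwarz:
  assumes Z: "entries_in BH n Z" and pos: "form_pos n Z"
  shows "(cmod (qform n Z g h))\<^sup>2 \<le> Re (qform n Z g g) * Re (qform n Z h h)"
proof -
  define A B C where "A = Re (qform n Z g g)" and "B = Re (qform n Z h h)" and "C = qform n Z g h"
  have nn: "0 \<le> A" "0 \<le> B" using pos by (auto simp: A_def B_def form_pos_def less_eq_complex_def)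
  have herm: "qform n Z h g = cnj C"
    unfolding C_def by (rule form_real_hermitian[OF Z form_pos_imp_real[OF pos]])
  have key: "0 \<le> A - 2 * s * (cmod C)\<^sup>2 + s\<^sup>2 * (cmod C)\<^sup>2 * B" for s :: real
  proof -
    \<comment> \<open>With this coefficient both cross terms become the same real number - s |C|^2,
      so expanding the form at g + t h gives a real quadratic in s.\<close>
    define t where "t = - complex_of_real s * cnj C"
    have hh: "qform n Z h h = complex_of_real B"
      using form_pos_imp_real[OF pos, of h] by (simp add: B_def complex_eq_iff)
    have C2: "C * cnj C = complex_of_real ((cmod C)\<^sup>2)"
      by (rule complex_norm_square[symmetric, unfolded of_real_power[symmetric]])
    have "qform n Z (\<lambda>a. g a + t *\<^sub>C h a) (\<lambda>a. g a + t *\<^sub>C h a) =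
      qform n Z g g + t * C + cnj t * cnj C + cnj t * t * complex_of_real B"
      by (simp add: qform_add_left qform_add_right qform_scaleC_left qform_scaleC_right[OF Z]
        herm hh C_def[symmetric] algebra_simps)
    also have "\<dots> = qform n Z g g + complex_of_real (- 2 * s * (cmod C)\<^sup>2 + s\<^sup>2 * (cmod C)\<^sup>2 * B)"
    proof -
      have "t * C = - (complex_of_real s * (C * cnj C))"
        "cnj t * cnj C = - (complex_of_real s * (C * cnj C))"
        "cnj t * t = (complex_of_real s)\<^sup>2 * (C * cnj C)"
        by (simp_all add: t_def power2_eq_square mult_ac)
      then show ?thesis by (simp add: C2)
    qed
    finally have "Re (qform n Z (\<lambda>a. g a + t *\<^sub>C h a) (\<lambda>a. g a + t *\<^sub>C h a)) =
      A - 2 * s * (cmod C)\<^sup>2 + s\<^sup>2 * (cmod C)\<^sup>2 * B" by (simp add: A_def)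
    then show ?thesis using form_pos_Re[OF pos] by metis
  qed
  have "(cmod C)\<^sup>2 \<le> A * B"
  proof (cases "B = 0")
    case True
    \<comment> \<open>With B = 0 the quadratic in s is affine. This s would give A + 1 \<le> A
      unless C = 0, where division by zero makes the statement read 0 \<le> A.\<close>
    have "2 * ((A + 1) / 2 / (cmod C)\<^sup>2) * (cmod C)\<^sup>2 \<le> A"
      using key[of "(A + 1) / 2 / (cmod C)\<^sup>2"] True by simp
    then have "C = 0" by (cases "C = 0") auto
    then show ?thesis using True by simp
  next
    case False
    then have B: "0 < B" using nn by simp
    have "(1 / B)\<^sup>2 * (cmod C)\<^sup>2 * B = (cmod C)\<^sup>2 / B" using B by (simp add: power2_eq_square)
    then have "0 \<le> A - (cmod C)\<^sup>2 / B" using key[of "1 / B"] by simp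
    then show ?thesis using B by (simp add: field_simps)
  qed
  then show ?thesis unfolding A_def B_def C_def .
qed

section \<open>Complex matrices as forms over a one-dimensional Hilbert space; the Schur
  product\<close>

definition scalar_block :: "(nat \<times> nat \<Rightarrow> complex) \<Rightarrow> nat \<times> nat \<Rightarrow> complex \<Rightarrow>\<^sub>L complex"
  where "scalar_block X p = scaleC_op (X p) id_blinfun"

lemma qform_scalar_block:
  "qform n (scalar_block X) g h = (\<Sum>a<n. \<Sum>b<n. cnj (g a) * (X (a, b) * h b))"
  by (simp add: qform_def scalar_block_def cinner_complex_def scaleC_complex_def)

lemma entries_in_scalar_block: "entries_in BH n (scalar_block X)"
  by (simp add: entries_in_def BH_def scalar_block_def scaleC_complex_def)

lemma scalar_block_entry:
  assumes "a < n" "b < n"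
  shows "qform n (scalar_block X) (\<lambda>i. if i = a then 1 else 0) (\<lambda>j. if j = b then 1 else 0) = X (a, b)"
  using qform_delta[OF assms, of "scalar_block X" 1 1]
  by (simp add: scalar_block_def cinner_complex_def scaleC_complex_def)

lemma psd_mat_iff: "psd_mat n X \<longleftrightarrow> X \<in> carrier_mat n n \<and> form_pos n (scalar_block (($$) X))"
proof (cases "X \<in> carrier_mat n n")
  case True
  have eq: "(X *\<^sub>v v) \<bullet>c v = qform n (scalar_block (($$) X)) (vec_index v) (vec_index v)"
    if "v \<in> carrier_vec n" for v
  proof -
    have "(X *\<^sub>v v) \<bullet>c v = (\<Sum>a<n. (\<Sum>b<n. X $$ (a, b) * v $ b) * cnj (v $ a))"
      using True that by (simp add: scalar_prod_def mult_mat_vec_def row_def lessThan_atLeast0)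
    then show ?thesis
      by (simp add: qform_scalar_block sum_distrib_left sum_distrib_right mult.commute)
  qed
  have "form_pos n (scalar_block (($$) X))" if "psd_mat n X"
    unfolding form_pos_def
  proof
    fix h :: "nat \<Rightarrow> complex"
    have "0 \<le> qform n (scalar_block (($$) X)) (vec_index (Matrix.vec n h)) (vec_index (Matrix.vec n h))"
      using that unfolding psd_mat_def eq[OF vec_carrier, symmetric] by (blast intro: vec_carrier)
    then show "0 \<le> qform n (scalar_block (($$) X)) h h" by (simp add: qform_def)
  qed
  then show ?thesis using True eq by (auto simp: psd_mat_def form_pos_def)
qed (simp add: psd_mat_def)

text \<open>Each elimination step splits off a rank one form, on which \<open>Y\<close> is nonnegative.\<close>

lemma schur_product_sum_nonneg:
  assumes X: "form_pos n (scalar_block X)" and Y: "form_pos n (scalar_block Y)"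
  shows "0 \<le> (\<Sum>a<n. \<Sum>b<n. X (a, b) * Y (a, b))"
proof -
  \<comment> \<open>Gaussian elimination as an induction: k is the size of the leading corner
    outside which X vanishes, and k = n is no restriction.\<close>
  have "0 \<le> (\<Sum>a<n. \<Sum>b<n. X (a, b) * Y (a, b))"
    if "k \<le> n" "form_pos n (scalar_block X)" "\<forall>a<n. \<forall>b<n. k \<le> a \<or> k \<le> b \<longrightarrow> X (a, b) = 0" for k
    using that
  proof (induction k arbitrary: X)
    case 0
    then show ?case by (simp add: sum_nonneg)
  next
    case (Suc k)
    then have k: "k < n" by simp
    note CS = form_Cauchy_Schwarz[OF entries_in_scalar_block Suc.prems(2)]
    let ?e = "\<lambda>i. \<lambda>j::nat. if j = i then 1 else 0 :: complex"
    have herm: "X (a, b) = cnj (X (b, a))" if "a < n" "b < n" for a b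
      using form_real_hermitian[OF entries_in_scalar_block form_pos_imp_real[OF Suc.prems(2)], of "?e a" "?e b"]
      by (simp only: scalar_block_entry that)
    have "0 \<le> X (k, k)"
      using Suc.prems(2) scalar_block_entry[OF k k, of X] unfolding form_pos_def by metis
    then have "X (k, k) = complex_of_real (Re (X (k, k)))" "0 \<le> Re (X (k, k))"
      by (auto simp: less_eq_complex_def complex_eq_iff)
    then obtain d where d: "X (k, k) = complex_of_real d" "0 \<le> d" by blast
    show ?case
    proof (cases "d = 0")
      case True
      \<comment> \<open>A zero pivot kills its whole column, by Cauchy-Schwarz against the k-th
        basis vector.\<close>
      have z: "X (a, k) = 0" if "a < n" for a
        using CS[of "?e a" "?e k"] that k True d by (simp add: scalar_block_entry)
      then have z': "X (k, a) = 0" if "a < n" for a using herm[OF k that] that by simp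
      show ?thesis
      proof (rule Suc.IH)
        show "\<forall>a<n. \<forall>b<n. k \<le> a \<or> k \<le> b \<longrightarrow> X (a, b) = 0"
          using z z' Suc.prems(3) by (metis le_antisym not_less_eq_eq)
      qed (use k Suc.prems in auto)
    next
      case False
      then have dpos: "0 < d" using d by simp
      \<comment> \<open>Schur complement of the pivot: row and column k are cleared, and
        Cauchy-Schwarz against the k-th basis vector is exactly the inequality that keeps X'
        positive.\<close>
      define X' where "X' = (\<lambda>(a, b). X (a, b) - X (a, k) * X (k, b) / complex_of_real d)"
      have q: "qform n (scalar_block X) (?e k) v = (\<Sum>b<n. X (k, b) * v b)" for v
      proof -
        have "qform n (scalar_block X) (?e k) v = (\<Sum>a<n. if a = k then (\<Sum>b<n. X (k, b) * v b) else 0)"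
          unfolding qform_scalar_block by (intro sum.cong refl) auto
        then show ?thesis using k by (simp add: sum.delta)
      qed
      have rank1: "(\<Sum>a<n. \<Sum>b<n. cnj (v a) * (X (a, k) * X (k, b) * v b)) =
        complex_of_real ((cmod (qform n (scalar_block X) (?e k) v))\<^sup>2)" for v
      proof -
        have "(\<Sum>a<n. \<Sum>b<n. cnj (v a) * (X (a, k) * X (k, b) * v b)) =
          (\<Sum>a<n. \<Sum>b<n. cnj (X (k, a) * v a) * (X (k, b) * v b))"
        proof (intro sum.cong refl)
          fix a b assume "a \<in> {..<n}" "b \<in> {..<n}"
          then have "X (a, k) = cnj (X (k, a))" using k by (intro herm) auto
          then show "cnj (v a) * (X (a, k) * X (k, b) * v b) = cnj (X (k, a) * v a) * (X (k, b) * v b)"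
            by simp
        qed
        also have "\<dots> = cnj (qform n (scalar_block X) (?e k) v) * qform n (scalar_block X) (?e k) v"
          unfolding q by (simp only: cnj_sum sum_product)
        also have "\<dots> = complex_of_real ((cmod (qform n (scalar_block X) (?e k) v))\<^sup>2)"
          by (simp add: complex_norm_square[unfolded of_real_power] mult.commute)
        finally show ?thesis .
      qed
      have "form_pos n (scalar_block X')"
        unfolding form_pos_def
      proof
        fix v :: "nat \<Rightarrow> complex"
        have "qform n (scalar_block X') v v = qform n (scalar_block X) v v -
          (\<Sum>a<n. \<Sum>b<n. cnj (v a) * (X (a, k) * X (k, b) * v b)) / complex_of_real d"
          unfolding qform_scalar_block X'_def
          by (simp add: sum_divide_distrib sum_subtractf[symmetric] algebra_simps diff_divide_distrib)
        also have "\<dots> = qform n (scalar_block X) v v -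
          complex_of_real ((cmod (qform n (scalar_block X) (?e k) v))\<^sup>2 / d)"
          unfolding rank1 by simp
        finally have eq: "qform n (scalar_block X') v v = qform n (scalar_block X) v v -
          complex_of_real ((cmod (qform n (scalar_block X) (?e k) v))\<^sup>2 / d)" .
        have "(cmod (qform n (scalar_block X) (?e k) v))\<^sup>2 \<le> d * Re (qform n (scalar_block X) v v)"
          using CS[of "?e k" v] d by (simp add: scalar_block_entry[OF k k])
        then have "(cmod (qform n (scalar_block X) (?e k) v))\<^sup>2 / d \<le> Re (qform n (scalar_block X) v v)"
          using dpos by (simp add: field_simps)
        then show "0 \<le> qform n (scalar_block X') v v"
          using form_pos_imp_real[OF Suc.prems(2), of v] unfolding eq by (simp add: less_eq_complex_def)
      qed
      moreover have "\<forall>a<n. \<forall>b<n. k \<le> a \<or> k \<le> b \<longrightarrow> X' (a, b) = 0"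
      proof (intro allI impI)
        fix a b assume ab: "a < n" "b < n" "k \<le> a \<or> k \<le> b"
        show "X' (a, b) = 0"
        proof (cases "a = k \<or> b = k")
          case True
          then show ?thesis using d dpos by (auto simp: X'_def)
        next
          case False
          then have s: "Suc k \<le> a \<or> Suc k \<le> b" using ab by auto
          then have "X (a, b) = 0" "X (a, k) = 0 \<or> X (k, b) = 0" using Suc.prems(3) ab k by auto
          then show ?thesis by (auto simp: X'_def)
        qed
      qed
      ultimately have "0 \<le> (\<Sum>a<n. \<Sum>b<n. X' (a, b) * Y (a, b))"
        using k by (intro Suc.IH) auto
      moreover have "0 \<le> qform n (scalar_block Y) (\<lambda>b. X (k, b)) (\<lambda>b. X (k, b))"
        using Y unfolding form_pos_def by blast
      \<comment> \<open>Hermiticity turns the removed part X(a,k) X(k,b) into cnj(X(k,a)) X(k,b), so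
        summing it against Y gives the form of Y at row k of X.\<close>
      moreover have "(\<Sum>a<n. \<Sum>b<n. X (a, b) * Y (a, b)) = (\<Sum>a<n. \<Sum>b<n. X' (a, b) * Y (a, b)) +
        qform n (scalar_block Y) (\<lambda>b. X (k, b)) (\<lambda>b. X (k, b)) / complex_of_real d"
      proof -
        have "qform n (scalar_block Y) (\<lambda>b. X (k, b)) (\<lambda>b. X (k, b)) =
          (\<Sum>a<n. \<Sum>b<n. X (a, k) * X (k, b) * Y (a, b))"
          unfolding qform_scalar_block
        proof (intro sum.cong refl)
          fix a b assume "a \<in> {..<n}" "b \<in> {..<n}"
          then have "X (a, k) = cnj (X (k, a))" using k by (intro herm) auto
          then show "cnj (X (k, a)) * (Y (a, b) * X (k, b)) = X (a, k) * X (k, b) * Y (a, b)"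
            by simp
        qed
        then show ?thesis
          by (simp add: X'_def sum_divide_distrib sum.distrib[symmetric] algebra_simps)
      qed
      ultimately show ?thesis using dpos by (simp add: less_eq_complex_def)
    qed
  qed
  from this[of n] X show ?thesis by auto
qed

section \<open>Tensor products, positivity and partial transposes in terms of forms\<close>

lemma opmat_pos_iff: "opmat_pos n T \<longleftrightarrow> T \<in> carrier_mat n n \<and> form_pos n (($$) T)"
proof (cases "T \<in> carrier_mat n n")
  case True
  have eq: "dsum_inner h (opmat_apply T h) = qform n (($$) T) (vec_index h) (vec_index h)"
    if "h \<in> carrier_vec n" for h
    using True that by (simp add: dsum_inner_def opmat_apply_def qform_def cinner_sum_right)
  have "form_pos n (($$) T)" if "opmat_pos n T"
    unfolding form_pos_def
  proof
    fix h :: "nat \<Rightarrow> 'a"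
    have "0 \<le> qform n (($$) T) (vec_index (Matrix.vec n h)) (vec_index (Matrix.vec n h))"
      using that unfolding opmat_pos_def eq[OF vec_carrier, symmetric] by (blast intro: vec_carrier)
    then show "0 \<le> qform n (($$) T) h h" by (simp add: qform_def)
  qed
  then show ?thesis using True eq by (auto simp: opmat_pos_def form_pos_def)
qed (simp add: opmat_pos_def)

lemma csubspace_op_sum:
  assumes "csubspace_op S" "\<And>i. i \<in> I \<Longrightarrow> f i \<in> S"
  shows "sum f I \<in> S"
  using assms by (induction I rule: infinite_finite_induct) (auto simp: csubspace_op_def)

lemma tensor_sum_carrier [simp]: "tensor_sum n m s x \<in> carrier_mat n n"
  by (simp add: tensor_sum_def)

lemma tensor_sum_entry:
  "a < n \<Longrightarrow> b < n \<Longrightarrow> tensor_sum n m s x $$ (a, b) = (\<Sum>j<m. scaleC_op (x j $$ (a, b)) (s j))"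
  by (simp add: tensor_sum_def)

lemma tensor_sum_entries_in:
  assumes "csubspace_op S" "\<forall>j<m. s j \<in> S"
  shows "entries_in S n (($$) (tensor_sum n m s x))"
  using assms csubspace_op_sum[OF assms(1), of "{..<m}"]
  by (auto simp: entries_in_def tensor_sum_entry csubspace_op_def)

lemma tensor_sum_transpose:
  assumes "\<forall>j<m. x j \<in> carrier_mat n n" "a < n" "b < n"
  shows "tensor_sum n m s (\<lambda>j. transpose_mat (x j)) $$ (a, b) = tensor_sum n m s x $$ (b, a)"
  using assms by (auto simp: tensor_sum_entry intro!: sum.cong)

lemma sum_div_mod:
  fixes f :: "nat \<Rightarrow> nat \<Rightarrow> 'b::comm_monoid_add"
  shows "(\<Sum>p<n * k. f (p div k) (p mod k)) = (\<Sum>i<n. \<Sum>a<k. f i a)"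
proof -
  have "(\<Sum>i<n. \<Sum>a<k. f i a) = (\<Sum>i<n. \<Sum>p = i * k..<i * k + k. f (p div k) (p mod k))"
  proof (rule sum.cong[OF refl])
    fix i
    have "(\<Sum>p = 0 + i * k..<k + i * k. f (p div k) (p mod k)) =
      (\<Sum>a = 0..<k. f ((a + i * k) div k) ((a + i * k) mod k))"
      using sum.shift_bounds_nat_ivl[of "\<lambda>p. f (p div k) (p mod k)" 0 "i * k" k] by simp
    also have "\<dots> = (\<Sum>a<k. f i a)"
      unfolding lessThan_atLeast0 by (intro sum.cong refl) auto
    finally show "(\<Sum>a<k. f i a) = (\<Sum>p = i * k..<i * k + k. f (p div k) (p mod k))"
      by (simp add: add.commute)
  qed
  also have "\<dots> = (\<Sum>p<n * k. f (p div k) (p mod k))"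
    by (rule sum.nat_group)
  finally show ?thesis ..
qed

text \<open>Expansion in matrix units: T is the sum of its entries tensored with the units E_ij. A
  single summation index j encodes the pair (j div n, j mod n).\<close>

lemma entries_in_tensor_sum:
  assumes T: "T \<in> carrier_mat n n" "entries_in S n (($$) T)"
  obtains m s x where "T = tensor_sum n m s x" "\<forall>j<m. s j \<in> S \<and> x j \<in> carrier_mat n n"
proof -
  define s where "s = (\<lambda>j. T $$ (j div n, j mod n))"
  define x where "x = (\<lambda>j. Matrix.mat n n (\<lambda>p. if p = (j div n, j mod n) then 1 else 0 :: complex))"
  have "T = tensor_sum n (n * n) s x"
  proof (rule eq_matI)
    fix a b assume "a < dim_row (tensor_sum n (n * n) s x)" "b < dim_col (tensor_sum n (n * n) s x)"
    then have ab: "a < n" "b < n" by (auto simp: tensor_sum_def)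
    have "tensor_sum n (n * n) s x $$ (a, b) =
      (\<Sum>j<n * n. scaleC_op (if (a, b) = (j div n, j mod n) then 1 else 0) (T $$ (j div n, j mod n)))"
      using ab by (simp add: tensor_sum_entry x_def s_def)
    also have "\<dots> = (\<Sum>i<n. \<Sum>j<n. scaleC_op (if (a, b) = (i, j) then 1 else 0) (T $$ (i, j)))"
      by (rule sum_div_mod)
    also have "\<dots> = (\<Sum>i<n. \<Sum>j<n. if i = a then if j = b then T $$ (a, b) else 0 else 0)"
      using scaleC_of_real[of 1] by (intro sum.cong refl) (auto intro!: blinfun_eqI)
    also have "\<dots> = (\<Sum>i<n. if i = a then T $$ (a, b) else 0)"
      using ab by (intro sum.cong refl) (simp add: sum.delta)
    also have "\<dots> = T $$ (a, b)"
      using ab by (simp add: sum.delta)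
    finally show "T $$ (a, b) = tensor_sum n (n * n) s x $$ (a, b)" by simp
  qed (use T in \<open>auto simp: tensor_sum_def\<close>)
  moreover have "\<forall>j<n * n. s j \<in> S \<and> x j \<in> carrier_mat n n"
  proof (intro allI impI)
    fix j assume j: "j < n * n"
    then have "0 < n" by (cases n) auto
    then show "s j \<in> S \<and> x j \<in> carrier_mat n n"
      using T j by (auto simp: s_def x_def entries_in_def less_mult_imp_div_less)
  qed
  ultimately show ?thesis using that by blast
qed

lemma tensor_space_iff:
  assumes "csubspace_op S"
  shows "T \<in> tensor_space S n \<longleftrightarrow> T \<in> carrier_mat n n \<and> entries_in S n (($$) T)"
proof
  assume "T \<in> tensor_space S n"
  then show "T \<in> carrier_mat n n \<and> entries_in S n (($$) T)"
    using tensor_sum_entries_in[OF assms] by (auto simp: tensor_space_def)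
next
  assume "T \<in> carrier_mat n n \<and> entries_in S n (($$) T)"
  then show "T \<in> tensor_space S n"
    using entries_in_tensor_sum[of T n S] unfolding tensor_space_def by blast
qed

text \<open>Transposing every x_j exchanges the two indices of the block and leaves the operator
  entries alone, so the second positivity condition does not depend on how T is written as a sum of
  tensors.\<close>

lemma Jset_iff:
  assumes "csubspace_op S"
  shows "T \<in> Jset n S \<longleftrightarrow> T \<in> carrier_mat n n \<and> entries_in S n (($$) T) \<and>
    form_pos n (($$) T) \<and> form_pos n (\<lambda>(a, b). T $$ (b, a))"
proof -
  have tr: "opmat_pos n (tensor_sum n m s (\<lambda>j. transpose_mat (x j))) \<longleftrightarrow>
    form_pos n (\<lambda>(a, b). tensor_sum n m s x $$ (b, a))" if "\<forall>j<m. s j \<in> S \<and> x j \<in> carrier_mat n n"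
    for m s and x :: "nat \<Rightarrow> complex mat"
    unfolding opmat_pos_iff using that
    by (auto intro!: form_pos_cong simp: tensor_sum_transpose)
  show ?thesis
  proof
    assume "T \<in> Jset n S"
    then obtain m s x where T: "T = tensor_sum n m s x" "\<forall>j<m. s j \<in> S \<and> x j \<in> carrier_mat n n"
      "opmat_pos n T" "opmat_pos n (tensor_sum n m s (\<lambda>j. transpose_mat (x j)))"
      unfolding Jset_def by blast
    then show "T \<in> carrier_mat n n \<and> entries_in S n (($$) T) \<and>
        form_pos n (($$) T) \<and> form_pos n (\<lambda>(a, b). T $$ (b, a))"
      using tr[OF T(2)] tensor_sum_entries_in[OF assms] by (auto simp: opmat_pos_iff)
  next
    assume R: "T \<in> carrier_mat n n \<and> entries_in S n (($$) T) \<and>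
        form_pos n (($$) T) \<and> form_pos n (\<lambda>(a, b). T $$ (b, a))"
    then obtain m s x where T: "T = tensor_sum n m s x" "\<forall>j<m. s j \<in> S \<and> x j \<in> carrier_mat n n"
      using entries_in_tensor_sum[of T n S] by blast
    then show "T \<in> Jset n S" using R tr[OF T(2)] unfolding Jset_def opmat_pos_iff by blast
  qed
qed

section \<open>Linear maps as functionals\<close>

definition pairing ::
    "nat \<Rightarrow> (('h::chilbert_space \<Rightarrow>\<^sub>L 'h) \<Rightarrow> complex mat) \<Rightarrow> (nat \<times> nat \<Rightarrow> 'h \<Rightarrow>\<^sub>L 'h) \<Rightarrow> complex"
  where "pairing n \<phi> Z = (\<Sum>a<n. \<Sum>b<n. \<phi> (Z (a, b)) $$ (a, b))"

lemma linear_map_plus_entry: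
  assumes "linear_map S n \<phi>" "s \<in> S" "t \<in> S" "a < n" "b < n"
  shows "\<phi> (s + t) $$ (a, b) = \<phi> s $$ (a, b) + \<phi> t $$ (a, b)"
  using assms by (auto simp: linear_map_def)

lemma linear_map_scaleC_entry:
  assumes "linear_map S n \<phi>" "s \<in> S" "a < n" "b < n"
  shows "\<phi> (scaleC_op c s) $$ (a, b) = c * \<phi> s $$ (a, b)"
  using assms by (auto simp: linear_map_def)

lemma linear_map_sum:
  assumes S: "csubspace_op S" and \<phi>: "linear_map S n \<phi>" and f: "\<And>i. i \<in> I \<Longrightarrow> f i \<in> S"
    and ab: "a < n" "b < n"
  shows "\<phi> (sum f I) $$ (a, b) = (\<Sum>i\<in>I. \<phi> (f i) $$ (a, b))"
proof -
  have z: "\<phi> 0 $$ (a, b) = 0"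
    using linear_map_sum_entry[OF S \<phi> _ ab, of 0] by simp
  show ?thesis
    using f
  proof (induction I rule: infinite_finite_induct)
    case (insert x F)
    then have "sum f F \<in> S" "f x \<in> S" by (auto intro!: csubspace_op_sum[OF S])
    then show ?case using insert ab by (simp add: linear_map_plus_entry[OF \<phi>])
  qed (simp_all add: z)
qed

lemma pairing_cong:
  "(\<And>a b. a < n \<Longrightarrow> b < n \<Longrightarrow> Y (a, b) = Z (a, b)) \<Longrightarrow> pairing n \<phi> Y = pairing n \<phi> Z"
  by (simp add: pairing_def)

lemma pairing_plus:
  assumes "linear_map S n \<phi>" "entries_in S n Y" "entries_in S n Z"
  shows "pairing n \<phi> (Y + Z) = pairing n \<phi> Y + pairing n \<phi> Z"
  using assms by (simp add: pairing_def entries_in_def linear_map_plus_entry[OF assms(1)] sum.distrib)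

lemma pairing_scaleC:
  assumes "linear_map S n \<phi>" "entries_in S n Z"
  shows "pairing n \<phi> (\<lambda>p. scaleC_op c (Z p)) = c * pairing n \<phi> Z"
  using assms by (simp add: pairing_def entries_in_def linear_map_scaleC_entry[OF assms(1)] sum_distrib_left)

lemma pairing_scaleR:
  assumes "linear_map S n \<phi>" "entries_in S n Z"
  shows "pairing n \<phi> (r *\<^sub>R Z) = complex_of_real r * pairing n \<phi> Z"
  using pairing_scaleC[OF assms, of "complex_of_real r"]
  by (simp add: scaleC_op_of_real scaleR_fun_def)

text \<open>Transposing the values of \<phi> is dual to the partial transpose of the argument; this
  converts co-cp statements into cp statements.\<close>

lemma pairing_transpose:
  assumes "linear_map S n \<phi>" "entries_in S n Z"
  shows "pairing n (\<lambda>s. transpose_mat (\<phi> s)) Z = pairing n \<phi> (\<lambda>(a, b). Z (b, a))"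
proof -
  have "pairing n (\<lambda>s. transpose_mat (\<phi> s)) Z = (\<Sum>a<n. \<Sum>b<n. \<phi> (Z (a, b)) $$ (b, a))"
    unfolding pairing_def
  proof (rule sum.cong[OF refl], rule sum.cong[OF refl])
    fix a b assume "a \<in> {..<n}" "b \<in> {..<n}"
    moreover from this have "\<phi> (Z (a, b)) \<in> carrier_mat n n"
      using assms by (auto simp: linear_map_def entries_in_def)
    ultimately show "transpose_mat (\<phi> (Z (a, b))) $$ (a, b) = \<phi> (Z (a, b)) $$ (b, a)" by auto
  qed
  also have "\<dots> = pairing n \<phi> (\<lambda>(a, b). Z (b, a))"
    unfolding pairing_def by (subst sum.swap) simp
  finally show ?thesis .
qed

lemma entries_in_plus:
  "csubspace_op S \<Longrightarrow> entries_in S n Y \<Longrightarrow> entries_in S n Z \<Longrightarrow> entries_in S n (Y + Z)"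
  by (simp add: entries_in_def csubspace_op_def)

lemma entries_in_scaleR:
  "csubspace_op S \<Longrightarrow> entries_in S n Z \<Longrightarrow> entries_in S n (r *\<^sub>R Z)"
  by (metis (no_types, lifting) csubspace_op_def entries_in_def scaleC_op_of_real scaleR_fun_apply)

lemma entries_in_swap: "entries_in S n Z \<Longrightarrow> entries_in S n (\<lambda>(a, b). Z (b, a))"
  by (simp add: entries_in_def)

lemma entries_in_unit_block:
  "csubspace_op S \<Longrightarrow> id_blinfun \<in> S \<Longrightarrow> entries_in S n unit_block"
  by (simp add: entries_in_def unit_block_def csubspace_op_def)

section \<open>Complete positivity as nonnegativity of the pairing\<close>

lemma qform_ampl:
  "qform (n * k) (scalar_block (($$) (ampl n k \<phi> T))) v v =
    (\<Sum>i<n. \<Sum>a<k. \<Sum>j<n. \<Sum>b<k.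
      cnj (v (i * k + a)) * (\<phi> (T $$ (a, b)) $$ (i, j) * v (j * k + b)))"
proof -
  define F where "F = (\<lambda>i a j b. cnj (v (i * k + a)) * (\<phi> (T $$ (a, b)) $$ (i, j) * v (j * k + b)))"
  have "qform (n * k) (scalar_block (($$) (ampl n k \<phi> T))) v v =
    (\<Sum>p<n * k. \<Sum>q<n * k. F (p div k) (p mod k) (q div k) (q mod k))"
    unfolding qform_scalar_block by (simp add: ampl_def F_def)
  also have "\<dots> = (\<Sum>p<n * k. \<Sum>j<n. \<Sum>b<k. F (p div k) (p mod k) j b)"
    by (intro sum.cong[OF refl] sum_div_mod)
  also have "\<dots> = (\<Sum>i<n. \<Sum>a<k. \<Sum>j<n. \<Sum>b<k. F i a j b)"
    by (rule sum_div_mod)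
  finally show ?thesis unfolding F_def .
qed

text \<open>The pairing is the quadratic form of the n-th amplification at one vector, the sum of
  all e_i \<otimes> e_i.\<close>

lemma cp_map_imp_pairing:
  assumes S: "csubspace_op S" and \<phi>: "cp_map S n \<phi>"
    and Z: "entries_in S n Z" "form_pos n Z"
  shows "0 \<le> pairing n \<phi> Z"
proof -
  define T where "T = Matrix.mat n n Z"
  have T: "T $$ (a, b) = Z (a, b)" if "a < n" "b < n" for a b using that by (simp add: T_def)
  have "form_pos n (($$) T)" using Z(2) form_pos_cong[of n "($$) T" Z] T by simp
  then have "opmat_pos n T" unfolding opmat_pos_iff by (simp add: T_def)
  moreover have "T \<in> tensor_space S n"
    unfolding tensor_space_iff[OF S] using Z(1) by (simp add: entries_in_def T_def)
  ultimately have "psd_mat (n * n) (ampl n n \<phi> T)" using \<phi> unfolding cp_map_def by blast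
  \<comment> \<open>Coordinates of the sum of the e_i \<otimes> e_i: index p = i * n + a carries 1
    exactly when i = a.\<close>
  then have "0 \<le> qform (n * n) (scalar_block (($$) (ampl n n \<phi> T)))
    (\<lambda>p. if p div n = p mod n then 1 else 0) (\<lambda>p. if p div n = p mod n then 1 else 0)"
    unfolding psd_mat_iff form_pos_def by blast
  also have "\<dots> = (\<Sum>i<n. \<Sum>a<n. \<Sum>j<n. \<Sum>b<n.
      if a = i then if b = j then \<phi> (T $$ (a, b)) $$ (i, j) else 0 else 0)"
    unfolding qform_ampl
    by (rule sum.cong[OF refl])+ (auto simp: div_mult_self3)
  also have "\<dots> = (\<Sum>i<n. \<Sum>a<n. if a = i then \<Sum>j<n. \<phi> (T $$ (i, j)) $$ (i, j) else 0)"
    by (rule sum.cong[OF refl])+ (auto simp: sum.delta)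
  also have "\<dots> = pairing n \<phi> Z"
    unfolding pairing_def by (simp add: sum.delta T)
  finally show ?thesis .
qed

text \<open>Level n controls all levels k: the quadratic form of the k-th amplification at a vector
  v equals the pairing with T compressed by the coefficient matrix of v, and compression preserves
  positivity.\<close>

lemma pairing_imp_cp_map:
  assumes S: "csubspace_op S" and \<phi>: "linear_map S n \<phi>"
    and pos: "\<And>Z. entries_in S n Z \<Longrightarrow> form_pos n Z \<Longrightarrow> 0 \<le> pairing n \<phi> Z"
  shows "cp_map S n \<phi>"
  unfolding cp_map_def
proof (intro conjI allI ballI impI)
  fix k T assume "T \<in> tensor_space S k" "opmat_pos k T"
  then have T: "entries_in S k (($$) T)" "form_pos k (($$) T)"
    using tensor_space_iff[OF S] opmat_pos_iff by auto
  show "psd_mat (n * k) (ampl n k \<phi> T)"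
    unfolding psd_mat_iff form_pos_def
  proof (intro conjI allI)
    show "ampl n k \<phi> T \<in> carrier_mat (n * k) (n * k)" by (simp add: ampl_def)
    fix v :: "nat \<Rightarrow> complex"
    \<comment> \<open>This is V* T V, where V has the coordinates of v as scalar entries; its form
      at h is the form of T at V h, which is the vector \<open>w\<close> below.\<close>
    define Z where "Z = (\<lambda>(i, j). \<Sum>a<k. \<Sum>b<k.
      scaleC_op (cnj (v (i * k + a)) * v (j * k + b)) (T $$ (a, b)))"
    have TS: "scaleC_op c (T $$ (a, b)) \<in> S" if "a < k" "b < k" for a b c
      using T(1) S that by (simp add: entries_in_def csubspace_op_def)
    have row: "(\<Sum>b<k. scaleC_op (c b) (T $$ (a, b))) \<in> S" if "a < k" for a c
      using TS that by (intro csubspace_op_sum[OF S]) auto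
    have "pairing n \<phi> Z = (\<Sum>i<n. \<Sum>j<n. \<Sum>a<k. \<Sum>b<k.
      cnj (v (i * k + a)) * (\<phi> (T $$ (a, b)) $$ (i, j) * v (j * k + b)))"
      unfolding pairing_def Z_def prod.case
    proof (rule sum.cong[OF refl], rule sum.cong[OF refl])
      fix i j assume ij: "i \<in> {..<n}" "j \<in> {..<n}"
      have "\<phi> (\<Sum>a<k. \<Sum>b<k. scaleC_op (cnj (v (i * k + a)) * v (j * k + b)) (T $$ (a, b))) $$ (i, j) =
        (\<Sum>a<k. \<phi> (\<Sum>b<k. scaleC_op (cnj (v (i * k + a)) * v (j * k + b)) (T $$ (a, b))) $$ (i, j))"
        using ij row by (intro linear_map_sum[OF S \<phi>]) auto
      also have "\<dots> = (\<Sum>a<k. \<Sum>b<k. \<phi> (scaleC_op (cnj (v (i * k + a)) * v (j * k + b)) (T $$ (a, b))) $$ (i, j))"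
        using ij TS by (intro sum.cong[OF refl] linear_map_sum[OF S \<phi>]) auto
      also have "\<dots> = (\<Sum>a<k. \<Sum>b<k. cnj (v (i * k + a)) * (\<phi> (T $$ (a, b)) $$ (i, j) * v (j * k + b)))"
        using ij T(1) by (intro sum.cong[OF refl])
          (auto simp: linear_map_scaleC_entry[OF \<phi>] entries_in_def)
      finally show "\<phi> (\<Sum>a<k. \<Sum>b<k. scaleC_op (cnj (v (i * k + a)) * v (j * k + b)) (T $$ (a, b))) $$ (i, j) =
        (\<Sum>a<k. \<Sum>b<k. cnj (v (i * k + a)) * (\<phi> (T $$ (a, b)) $$ (i, j) * v (j * k + b)))" .
    qed
    also have "\<dots> = qform (n * k) (scalar_block (($$) (ampl n k \<phi> T))) v v"
      unfolding qform_ampl by (intro sum.cong[OF refl] sum.swap)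
    finally have eq: "pairing n \<phi> Z = qform (n * k) (scalar_block (($$) (ampl n k \<phi> T))) v v" .
    have ZS: "entries_in S n Z"
      unfolding entries_in_def Z_def using TS by (auto intro!: csubspace_op_sum[OF S])
    moreover have "form_pos n Z"
      unfolding form_pos_def
    proof
      fix h :: "nat \<Rightarrow> 'a"
      define w where "w = (\<lambda>a. \<Sum>i<n. v (i * k + a) *\<^sub>C h i)"
      let ?c = "\<lambda>i j a b. cnj (v (i * k + a)) * v (j * k + b) * cinner (h i) (blinfun_apply (T $$ (a, b)) (h j))"
      have "qform n Z h h = (\<Sum>i<n. \<Sum>j<n. \<Sum>a<k. \<Sum>b<k. ?c i j a b)"
        unfolding qform_def Z_def
        by (simp add: blinfun.sum_left cinner_sum_right cinner_scaleC_right)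
      also have "\<dots> = (\<Sum>a<k. \<Sum>b<k. \<Sum>i<n. \<Sum>j<n. ?c i j a b)"
      proof -
        have "(\<Sum>i<n. \<Sum>j<n. \<Sum>a<k. \<Sum>b<k. ?c i j a b) = (\<Sum>i<n. \<Sum>a<k. \<Sum>j<n. \<Sum>b<k. ?c i j a b)"
          by (intro sum.cong[OF refl] sum.swap)
        also have "\<dots> = (\<Sum>a<k. \<Sum>i<n. \<Sum>j<n. \<Sum>b<k. ?c i j a b)" by (rule sum.swap)
        also have "\<dots> = (\<Sum>a<k. \<Sum>i<n. \<Sum>b<k. \<Sum>j<n. ?c i j a b)"
          by (intro sum.cong[OF refl] sum.swap)
        also have "\<dots> = (\<Sum>a<k. \<Sum>b<k. \<Sum>i<n. \<Sum>j<n. ?c i j a b)"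
          by (intro sum.cong[OF refl] sum.swap)
        finally show ?thesis .
      qed
      also have "\<dots> = qform k (($$) T) w w"
        unfolding qform_def
      proof (rule sum.cong[OF refl], rule sum.cong[OF refl])
        fix a b assume "a \<in> {..<k}" "b \<in> {..<k}"
        then have "T $$ (a, b) \<in> BH" using T(1) S by (auto simp: entries_in_def csubspace_op_def)
        then show "(\<Sum>i<n. \<Sum>j<n. ?c i j a b) = cinner (w a) (blinfun_apply (T $$ (a, b)) (w b))"
          by (subst sum.swap) (simp add: w_def blinfun.sum_right BH_apply cinner_sum_left cinner_sum_right
              cinner_scaleC_left cinner_scaleC_right sum_distrib_left mult_ac)
      qed
      also have "0 \<le> qform k (($$) T) w w" using T(2) unfolding form_pos_def by blast
      finally show "0 \<le> qform n Z h h" .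
    qed
    ultimately show "0 \<le> qform (n * k) (scalar_block (($$) (ampl n k \<phi> T))) v v"
      using pos eq by metis
  qed
qed (rule \<phi>)

section \<open>The operator norm of operator matrices\<close>

lemma dsum_norm_eq: "h \<in> carrier_vec n \<Longrightarrow> dsum_norm h = sqrt (sqnorm n (vec_index h))"
  by (simp add: dsum_norm_def dsum_inner_def sqnorm_def cinner_self)

lemma opmat_apply_index:
  "T \<in> carrier_mat n n \<Longrightarrow> a < n \<Longrightarrow>
    opmat_apply T h $ a = (\<Sum>b<n. blinfun_apply (T $$ (a, b)) (h $ b))"
  by (simp add: opmat_apply_def)

lemma opmat_apply_carrier: "T \<in> carrier_mat n n \<Longrightarrow> opmat_apply T h \<in> carrier_vec n"
  by (simp add: opmat_apply_def)

text \<open>Test T on vectors with a single nonzero coordinate. Since \<open>opmat_norm\<close> is a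
  supremum of reals, its set of values has to be shown bounded before the supremum can serve as an
  upper bound.\<close>

lemma norm_entry_le_opmat_norm:
  assumes T: "T \<in> carrier_mat n n" and ab: "a < n" "b < n"
  shows "norm (T $$ (a, b)) \<le> opmat_norm n T"
proof -
  let ?N = "{dsum_norm (opmat_apply T h) | h. h \<in> carrier_vec n \<and> dsum_norm h \<le> 1}"
  \<comment> \<open>Crude bound: on the unit ball every coordinate of h has norm at most 1.\<close>
  define C where "C = (\<Sum>a<n. (\<Sum>b<n. norm (T $$ (a, b)))\<^sup>2)"
  have bdd: "bdd_above ?N"
    unfolding bdd_above_def
  proof (intro exI[of _ "sqrt C"] ballI)
    fix y assume "y \<in> ?N"
    then obtain h where h: "h \<in> carrier_vec n" "dsum_norm h \<le> 1" "y = dsum_norm (opmat_apply T h)" by auto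
    have h1: "norm (h $ b) \<le> 1" if "b < n" for b
    proof -
      have "(norm (h $ b))\<^sup>2 \<le> sqnorm n (vec_index h)" using norm_le_sqnorm[OF that, of "vec_index h"] .
      also have "\<dots> \<le> 1" using h(2) by (simp add: dsum_norm_eq[OF h(1)])
      finally show ?thesis by (simp add: power_le_one_iff)
    qed
    have "norm (opmat_apply T h $ a) \<le> (\<Sum>b<n. norm (T $$ (a, b)))" if "a < n" for a
    proof -
      have "norm (opmat_apply T h $ a) \<le> (\<Sum>b<n. norm (blinfun_apply (T $$ (a, b)) (h $ b)))"
        unfolding opmat_apply_index[OF T that] by (rule norm_sum)
      also have "\<dots> \<le> (\<Sum>b<n. norm (T $$ (a, b)))"
      proof (rule sum_mono)
        fix b assume "b \<in> {..<n}"
        have "norm (blinfun_apply (T $$ (a, b)) (h $ b)) \<le> norm (T $$ (a, b)) * norm (h $ b)"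
          by (rule norm_blinfun)
        also have "\<dots> \<le> norm (T $$ (a, b)) * 1"
          using h1 \<open>b \<in> {..<n}\<close> by (intro mult_left_mono) auto
        finally show "norm (blinfun_apply (T $$ (a, b)) (h $ b)) \<le> norm (T $$ (a, b))" by simp
      qed
      finally show ?thesis .
    qed
    then have "sqnorm n (vec_index (opmat_apply T h)) \<le> C"
      unfolding sqnorm_def C_def by (intro sum_mono power_mono) auto
    then show "y \<le> sqrt C" using h(3) dsum_norm_eq[OF opmat_apply_carrier[OF T]] by simp
  qed
  have unit: "norm (blinfun_apply (T $$ (a, b)) x) \<le> opmat_norm n T" if x: "norm x \<le> 1" for x
  proof -
    define h where "h = Matrix.vec n (\<lambda>j. if j = b then x else 0)"
    have hc: "h \<in> carrier_vec n" by (simp add: h_def)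
    have "sqnorm n (vec_index h) = (\<Sum>j<n. if j = b then (norm x)\<^sup>2 else 0)"
      unfolding sqnorm_def by (intro sum.cong) (auto simp: h_def)
    then have "dsum_norm h \<le> 1" using x ab by (simp add: dsum_norm_eq[OF hc] sum.delta)
    then have "dsum_norm (opmat_apply T h) \<le> opmat_norm n T"
      unfolding opmat_norm_def using hc by (intro cSup_upper bdd) auto
    moreover have "opmat_apply T h $ a = blinfun_apply (T $$ (a, b)) x"
    proof -
      have "opmat_apply T h $ a = (\<Sum>j<n. if j = b then blinfun_apply (T $$ (a, b)) x else 0)"
        unfolding opmat_apply_index[OF T ab(1)] by (intro sum.cong) (auto simp: h_def)
      then show ?thesis using ab by (simp add: sum.delta)
    qed
    moreover have "norm (opmat_apply T h $ a) \<le> dsum_norm (opmat_apply T h)"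
      unfolding dsum_norm_eq[OF opmat_apply_carrier[OF T]]
      using norm_le_sqnorm[OF ab(1), of "vec_index (opmat_apply T h)"] by (rule real_le_rsqrt)
    ultimately show ?thesis by simp
  qed
  have "0 \<le> opmat_norm n T" using unit[of 0] by simp
  then show ?thesis
  proof (rule norm_blinfun_bound)
    fix x
    show "norm (blinfun_apply (T $$ (a, b)) x) \<le> opmat_norm n T * norm x"
    proof (cases "x = 0")
      case False
      then have "norm (blinfun_apply (T $$ (a, b)) ((1 / norm x) *\<^sub>R x)) \<le> opmat_norm n T"
        by (intro unit) simp
      then show ?thesis using False by (simp add: blinfun.scaleR_right field_simps)
    qed simp
  qed
qed

text \<open>For a Hermitian operator matrix the numerical radius dominates the norm:
  \<open>polarized_bound\<close> is applied to h and to the normalized image of h.\<close>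

lemma opmat_norm_le:
  assumes T: "T \<in> carrier_mat n n" and BH: "entries_in BH n (($$) T)"
    and real: "\<And>h. Im (qform n (($$) T) h h) = 0"
    and r: "form_bounded n r (($$) T)" "0 \<le> r"
  shows "opmat_norm n T \<le> r"
  unfolding opmat_norm_def
proof (rule cSup_least)
  have "dsum_norm (Matrix.vec n (\<lambda>_. 0 :: 'a)) \<le> 1"
    by (simp add: dsum_norm_eq[OF vec_carrier] sqnorm_def)
  then show "{dsum_norm (opmat_apply T h) | h. h \<in> carrier_vec n \<and> dsum_norm h \<le> 1} \<noteq> {}"
    using vec_carrier by blast
next
  fix y assume "y \<in> {dsum_norm (opmat_apply T h) | h. h \<in> carrier_vec n \<and> dsum_norm h \<le> 1}"
  then obtain h where h: "h \<in> carrier_vec n" "dsum_norm h \<le> 1" "y = dsum_norm (opmat_apply T h)" by auto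
  define g where "g = vec_index (opmat_apply T h)"
  define H where "H = vec_index h"
  have y2: "y\<^sup>2 = sqnorm n g"
    using h(3) dsum_norm_eq[OF opmat_apply_carrier[OF T], of h] by (simp add: g_def)
  have y0: "0 \<le> y" using h(3) dsum_norm_eq[OF opmat_apply_carrier[OF T], of h] by simp
  have "sqnorm n H \<le> 1" using h(2) by (simp add: dsum_norm_eq[OF h(1)] H_def)
  have gH: "qform n (($$) T) g H = complex_of_real (sqnorm n g)"
    by (simp add: qform_def g_def H_def opmat_apply_index[OF T] sqnorm_def cinner_sum_right[symmetric]
      cinner_self)
  show "y \<le> r"
  proof (cases "y = 0")
    case False
    then have ypos: "0 < y" using y0 by simp
    \<comment> \<open>Normalized so that the form at (u, H) is exactly y, the norm of the image of
      h.\<close>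
    define u where "u = (\<lambda>a. complex_of_real (1 / y) *\<^sub>C g a)"
    have "sqnorm n u = sqnorm n g / y\<^sup>2"
      by (simp add: u_def sqnorm_def norm_scaleC norm_divide power_mult_distrib power_divide sum_divide_distrib)
    then have u1: "sqnorm n u = 1" using False unfolding y2[symmetric] by simp
    have "qform n (($$) T) u H = complex_of_real y"
      using ypos unfolding u_def qform_scaleC_left gH by (simp add: y2[symmetric] power2_eq_square)
    then have "2 * y \<le> r * (sqnorm n u + sqnorm n H)"
      using polarized_bound[OF BH real r(1), of u H] ypos by simp
    also have "\<dots> \<le> r * (1 + 1)"
      using u1 \<open>sqnorm n H \<le> 1\<close> r(2) by (intro mult_left_mono) auto
    finally show ?thesis by simp
  qed (use r in simp)
qed

section \<open>Boundedness of positive maps\<close>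

lemma scaleC_op_scaleR: "scaleC_op c (r *\<^sub>R T) = r *\<^sub>R scaleC_op c T"
  by (simp add: scaleC_op_of_real[symmetric] scaleC_op_scaleC_op mult.commute)

lemma is_adjoint_norm_le:
  assumes "is_adjoint s s'"
  shows "norm s' \<le> norm s"
proof (rule norm_blinfun_bound)
  fix x
  let ?y = "blinfun_apply s' x"
  have "complex_of_real ((norm ?y)\<^sup>2) = cinner (blinfun_apply s ?y) x"
    using assms by (simp add: is_adjoint_def cinner_self)
  then have "(norm ?y)\<^sup>2 = Re (cinner (blinfun_apply s ?y) x)"
    by (metis Re_complex_of_real)
  also have "\<dots> \<le> norm (blinfun_apply s ?y) * norm x"
    using Re_cinner_le[of "blinfun_apply s ?y" x] by linarith
  also have "\<dots> \<le> norm s * norm ?y * norm x"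
    by (intro mult_right_mono norm_blinfun) auto
  finally have "norm ?y * norm ?y \<le> norm ?y * (norm s * norm x)"
    by (simp add: power2_eq_square mult_ac)
  then show "norm ?y \<le> norm s * norm x"
    by (cases "?y = 0") auto
qed simp

lemma is_adjoint_sym: "is_adjoint s s' \<Longrightarrow> is_adjoint s' s"
  unfolding is_adjoint_def by (metis cinner_commute)

lemma operator_system_csubspace: "operator_system A S \<Longrightarrow> csubspace_op S"
  by (simp add: operator_system_def)

lemma selfadjoint_plus_unit_pos:
  assumes S: "operator_system A S" and s: "s \<in> S" "is_adjoint s s" and r: "norm s \<le> r"
  shows "r *\<^sub>R id_blinfun + s \<in> pos_part S"
proof -
  have sub: "csubspace_op S" and one: "id_blinfun \<in> S" using S by (auto simp: operator_system_def)
  have "r *\<^sub>R id_blinfun \<in> S"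
    using sub one unfolding csubspace_op_def by (metis scaleC_op_of_real)
  then have inS: "r *\<^sub>R id_blinfun + s \<in> S" using sub s by (auto simp: csubspace_op_def)
  moreover have "0 \<le> cinner x (blinfun_apply (r *\<^sub>R id_blinfun + s) x)" for x
  proof -
    have "cinner x (blinfun_apply s x) = cnj (cinner x (blinfun_apply s x))"
      using s(2) cinner_commute[of "blinfun_apply s x" x] by (simp add: is_adjoint_def)
    then have "Im (cinner x (blinfun_apply s x)) = 0" by (simp add: complex_eq_iff)
    moreover have "\<bar>Re (cinner x (blinfun_apply s x))\<bar> \<le> r * (norm x)\<^sup>2"
    proof -
      have "norm (blinfun_apply s x) \<le> r * norm x"
        using norm_blinfun[of s x] mult_right_mono[OF r norm_ge_zero[of x]] by linarith
      then have "norm x * norm (blinfun_apply s x) \<le> norm x * (r * norm x)"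
        by (rule mult_left_mono) auto
      then show ?thesis using Re_cinner_le[of x "blinfun_apply s x"]
        by (simp add: power2_eq_square mult_ac)
    qed
    moreover have "cinner x (blinfun_apply (r *\<^sub>R id_blinfun + s) x) =
      complex_of_real (r * (norm x)\<^sup>2) + cinner x (blinfun_apply s x)"
      by (simp add: blinfun.add_left blinfun.scaleR_left cinner_add_right cinner_scaleR_right cinner_self)
    ultimately show ?thesis by (simp add: less_eq_complex_def)
  qed
  ultimately show ?thesis using sub by (auto simp: pos_part_def pos_op_def csubspace_op_def)
qed

lemma psd_mat_diag:
  assumes "psd_mat n M" "a < n"
  shows "0 \<le> M $$ (a, a)"
  using assms scalar_block_entry[OF assms(2,2), of "($$) M"]
  unfolding psd_mat_iff form_pos_def by metis

lemma psd_mat_entry_le_trace: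
  assumes M: "psd_mat n M" and ab: "a < n" "b < n"
  shows "cmod (M $$ (a, b)) \<le> (\<Sum>i<n. Re (M $$ (i, i)))"
proof -
  let ?t = "\<Sum>i<n. Re (M $$ (i, i))"
  have d: "0 \<le> Re (M $$ (i, i))" if "i < n" for i
    using psd_mat_diag[OF M that] by (simp add: less_eq_complex_def)
  have le: "Re (M $$ (i, i)) \<le> ?t" if "i < n" for i
    using that d by (intro member_le_sum[of i _ "\<lambda>i. Re (M $$ (i, i))"]) auto
  have t: "0 \<le> ?t" using d by (intro sum_nonneg) auto
  have "(cmod (M $$ (a, b)))\<^sup>2 \<le> Re (M $$ (a, a)) * Re (M $$ (b, b))"
    using form_Cauchy_Schwarz[OF entries_in_scalar_block, of n "($$) M"
        "\<lambda>i. if i = a then 1 else 0" "\<lambda>i. if i = b then 1 else 0"] M ab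
    unfolding psd_mat_iff by (simp add: scalar_block_entry)
  also have "\<dots> \<le> ?t * ?t" using le d ab t by (intro mult_mono) auto
  finally show ?thesis using t by (simp add: power2_eq_square[symmetric] power2_le_iff_abs_le)
qed

text \<open>For self-adjoint s with norm r both r 1 + s and r 1 - s are positive, hence so are their
  images. The second bounds the trace of \<psi> s from above, the first then bounds its entries
  through \<open>psd_mat_entry_le_trace\<close>. A general s is split as h + i k.\<close>

lemma positive_map_bounded:
  assumes S: "operator_system A S" and \<psi>: "positive_map S n \<psi>"
  obtains K where "0 \<le> K" "\<And>s a b. s \<in> S \<Longrightarrow> a < n \<Longrightarrow> b < n \<Longrightarrow> cmod (\<psi> s $$ (a, b)) \<le> K * norm s"
proof -
  have sub: "csubspace_op S" and one: "id_blinfun \<in> S" and sa: "selfadjoint_set S"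
    using S by (auto simp: operator_system_def)
  have lin: "linear_map S n \<psi>" using \<psi> by (simp add: positive_map_def)
  have pos: "psd_mat n (\<psi> s)" if "s \<in> pos_part S" for s
    using \<psi> that by (simp add: positive_map_def)
  define \<tau> where "\<tau> = (\<Sum>i<n. Re (\<psi> id_blinfun $$ (i, i)))"
  have "id_blinfun \<in> pos_part S"
    using one sub by (auto simp: pos_part_def pos_op_def csubspace_op_def cinner_self less_eq_complex_def)
  then have unit: "psd_mat n (\<psi> id_blinfun)" by (rule pos)
  have \<tau>: "0 \<le> \<tau>" unfolding \<tau>_def
    using psd_mat_diag[OF unit] by (intro sum_nonneg) (auto simp: less_eq_complex_def)
  have shift: "\<psi> (r *\<^sub>R id_blinfun + s) $$ (a, b) = complex_of_real r * \<psi> id_blinfun $$ (a, b) + \<psi> s $$ (a, b)"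
    if "s \<in> S" "a < n" "b < n" for r s a b
  proof -
    have "scaleC_op (complex_of_real r) id_blinfun \<in> S" using sub one by (auto simp: csubspace_op_def)
    from linear_map_plus_entry[OF lin this that] show ?thesis
      unfolding scaleC_op_of_real[symmetric] linear_map_scaleC_entry[OF lin one that(2,3)] .
  qed
  \<comment> \<open>Origin of the 3, with \<open>\<tau>\<close> the trace of the image of the unit:
    the trace of the image of r 1 + s is at most 2 r \<tau>, and removing the shift by r 1 costs
    another r \<tau>.\<close>
  have sabound: "cmod (\<psi> s $$ (a, b)) \<le> 3 * \<tau> * norm s"
    if s: "s \<in> S" "is_adjoint s s" and ab: "a < n" "b < n" for s a b
  proof -
    define r where "r = norm s"
    have ms: "scaleC_op (-1) s \<in> S" "is_adjoint (scaleC_op (-1) s) (scaleC_op (-1) s)"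
      using s sub by (auto simp: csubspace_op_def is_adjoint_def cinner_scaleC_left cinner_scaleC_right)
    have "norm (scaleC_op (-1) s) \<le> r" using norm_scaleC_op[of "-1" s] by (simp add: r_def)
    note p1 = pos[OF selfadjoint_plus_unit_pos[OF S s(1,2) order_refl, folded r_def]]
      and p2 = pos[OF selfadjoint_plus_unit_pos[OF S ms this]]
    have "0 \<le> (\<Sum>i<n. Re (\<psi> (r *\<^sub>R id_blinfun + scaleC_op (-1) s) $$ (i, i)))"
      using psd_mat_diag[OF p2] by (intro sum_nonneg) (auto simp: less_eq_complex_def)
    also have "\<dots> = r * \<tau> - (\<Sum>i<n. Re (\<psi> s $$ (i, i)))"
      using ms(1) s(1) by (simp add: shift linear_map_scaleC_entry[OF lin] \<tau>_def sum_subtractf sum_distrib_left)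
    finally have tr: "(\<Sum>i<n. Re (\<psi> s $$ (i, i))) \<le> r * \<tau>" by simp
    have "cmod (\<psi> (r *\<^sub>R id_blinfun + s) $$ (a, b)) \<le> (\<Sum>i<n. Re (\<psi> (r *\<^sub>R id_blinfun + s) $$ (i, i)))"
      by (rule psd_mat_entry_le_trace[OF p1 ab])
    also have "\<dots> = r * \<tau> + (\<Sum>i<n. Re (\<psi> s $$ (i, i)))"
      using s(1) by (simp add: shift \<tau>_def sum.distrib sum_distrib_left)
    finally have 1: "cmod (complex_of_real r * \<psi> id_blinfun $$ (a, b) + \<psi> s $$ (a, b)) \<le> 2 * (r * \<tau>)"
      using tr s(1) ab by (simp add: shift)
    have "cmod (complex_of_real r * \<psi> id_blinfun $$ (a, b)) \<le> r * \<tau>"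
      using psd_mat_entry_le_trace[OF unit ab] by (simp add: norm_mult r_def \<tau>_def mult_left_mono)
    moreover have "cmod (\<psi> s $$ (a, b)) \<le> cmod (complex_of_real r * \<psi> id_blinfun $$ (a, b) + \<psi> s $$ (a, b)) +
        cmod (complex_of_real r * \<psi> id_blinfun $$ (a, b))"
      using norm_triangle_ineq4[of "complex_of_real r * \<psi> id_blinfun $$ (a, b) + \<psi> s $$ (a, b)"
          "complex_of_real r * \<psi> id_blinfun $$ (a, b)"] by simp
    ultimately have "cmod (\<psi> s $$ (a, b)) \<le> 3 * (r * \<tau>)"
      using 1 by linarith
    then show ?thesis by (simp add: r_def mult_ac)
  qed
  have "cmod (\<psi> s $$ (a, b)) \<le> 6 * \<tau> * norm s" if s: "s \<in> S" and ab: "a < n" "b < n" for s a b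
  proof -
    obtain s' where s': "s' \<in> S" "is_adjoint s s'" using sa s unfolding selfadjoint_set_def by blast
    \<comment> \<open>Real and imaginary parts of s. Neither exceeds s in norm, so the constant
      doubles from 3 \<tau> to 6 \<tau>.\<close>
    define h k where "h = scaleC_op (1/2) (s + s')" and "k = scaleC_op (- \<i>/2) (s + scaleC_op (-1) s')"
    have adj: "cinner (blinfun_apply s x) y = cinner x (blinfun_apply s' y)"
      "cinner (blinfun_apply s' x) y = cinner x (blinfun_apply s y)" for x y
      using s'(2) is_adjoint_sym[OF s'(2)] by (auto simp: is_adjoint_def)
    have hk: "h \<in> S" "k \<in> S" using sub s s' by (auto simp: h_def k_def csubspace_op_def)
    have hsa: "is_adjoint h h" "is_adjoint k k"
      by (simp_all add: is_adjoint_def h_def k_def cinner_scaleC_left cinner_scaleC_right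
        blinfun.add_left cinner_add_left cinner_add_right adj algebra_simps)
    have "norm (s + s') \<le> 2 * norm s"
      using norm_triangle_ineq[of s s'] is_adjoint_norm_le[OF s'(2)] by linarith
    then have nh: "norm h \<le> norm s" using norm_scaleC_op[of "1/2" "s + s'"] by (simp add: h_def norm_divide)
    have "norm (s + scaleC_op (-1) s') \<le> 2 * norm s"
      using norm_triangle_ineq[of s "scaleC_op (-1) s'"] is_adjoint_norm_le[OF s'(2)]
        norm_scaleC_op[of "-1" s'] by simp
    then have nk: "norm k \<le> norm s"
      using norm_scaleC_op[of "- \<i>/2" "s + scaleC_op (-1) s'"] by (simp add: k_def norm_divide)
    have "s = h + scaleC_op \<i> k"
    proof (rule blinfun_eqI)
      fix x
      have "blinfun_apply (h + scaleC_op \<i> k) x = (1/2 :: complex) *\<^sub>C blinfun_apply s x + (1/2 :: complex) *\<^sub>C blinfun_apply s x"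
        using scaleC_add_left[of "1/2 :: complex" "-1/2" "blinfun_apply s' x"]
        by (simp add: h_def k_def blinfun.add_left scaleC_add_right scaleC_scaleC algebra_simps)
      also have "\<dots> = blinfun_apply s x"
        using scaleC_of_real[of 1 "blinfun_apply s x"] by (simp add: scaleC_add_left[symmetric])
      finally show "blinfun_apply s x = blinfun_apply (h + scaleC_op \<i> k) x" ..
    qed
    then have "\<psi> s $$ (a, b) = \<psi> (h + scaleC_op \<i> k) $$ (a, b)" by simp
    also have "\<dots> = \<psi> h $$ (a, b) + \<i> * \<psi> k $$ (a, b)"
      using hk sub ab by (simp add: linear_map_plus_entry[OF lin] linear_map_scaleC_entry[OF lin] csubspace_op_def)
    finally have "cmod (\<psi> s $$ (a, b)) \<le> cmod (\<psi> h $$ (a, b)) + cmod (\<psi> k $$ (a, b))"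
      using norm_triangle_ineq[of "\<psi> h $$ (a, b)" "\<i> * \<psi> k $$ (a, b)"] by (simp add: norm_mult)
    also have "\<dots> \<le> 3 * \<tau> * norm h + 3 * \<tau> * norm k"
      using sabound hk hsa ab by (intro add_mono) auto
    also have "\<dots> \<le> 3 * \<tau> * norm s + 3 * \<tau> * norm s"
      using nh nk \<tau> by (intro add_mono mult_left_mono) auto
    finally show ?thesis by simp
  qed
  then show ?thesis using that[of "6 * \<tau>"] \<tau> by simp
qed

section \<open>The cone generated by positive elementary tensors, and its closure\<close>

definition in_cone :: "('h::chilbert_space \<Rightarrow>\<^sub>L 'h) set \<Rightarrow> nat \<Rightarrow> (nat \<times> nat \<Rightarrow> 'h \<Rightarrow>\<^sub>L 'h) \<Rightarrow> bool"
  where "in_cone S n Z \<longleftrightarrow> (\<exists>U\<in>pos_tensor_cone S n. \<forall>a<n. \<forall>b<n. Z (a, b) = U $$ (a, b))"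

lemma in_cone_iff: "in_cone S n Z \<longleftrightarrow> (\<exists>(m::nat) c s x. (\<forall>j<m. 0 \<le> c j \<and> s j \<in> pos_part S \<and> psd_mat n (x j)) \<and>
    (\<forall>a<n. \<forall>b<n. Z (a, b) = (\<Sum>j<m. scaleC_op (x j $$ (a, b)) (c j *\<^sub>R s j))))"
    (is "_ = ?R")
proof
  assume "in_cone S n Z"
  then obtain m :: nat and c s x where "\<forall>j<m. 0 \<le> c j \<and> s j \<in> pos_part S \<and> psd_mat n (x j)"
    "\<forall>a<n. \<forall>b<n. Z (a, b) = tensor_sum n m (\<lambda>j. c j *\<^sub>R s j) x $$ (a, b)"
    unfolding in_cone_def pos_tensor_cone_def by blast
  then show ?R by (intro exI[of _ m] exI[of _ c] exI[of _ s] exI[of _ x]) (simp add: tensor_sum_entry)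
next
  assume ?R
  then obtain m :: nat and c s x where "\<forall>j<m. 0 \<le> c j \<and> s j \<in> pos_part S \<and> psd_mat n (x j)"
    "\<forall>a<n. \<forall>b<n. Z (a, b) = (\<Sum>j<m. scaleC_op (x j $$ (a, b)) (c j *\<^sub>R s j))"
    by blast
  then show "in_cone S n Z"
    unfolding in_cone_def pos_tensor_cone_def
    by (intro bexI[of _ "tensor_sum n m (\<lambda>j. c j *\<^sub>R s j) x"]) (auto simp: tensor_sum_entry)
qed

lemma in_cone_zero: "in_cone S n 0"
  unfolding in_cone_iff by (intro exI[of _ 0]) auto

lemma in_cone_tensor:
  "s \<in> pos_part S \<Longrightarrow> psd_mat n X \<Longrightarrow> in_cone S n (\<lambda>p. scaleC_op (X $$ p) s)"
  unfolding in_cone_iff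
  by (rule exI[of _ "1 :: nat"], rule exI[of _ "\<lambda>_. 1"], rule exI[of _ "\<lambda>_. s"], rule exI[of _ "\<lambda>_. X"]) simp

lemma in_cone_scaleR:
  assumes "in_cone S n Z" "0 \<le> r"
  shows "in_cone S n (r *\<^sub>R Z)"
proof -
  obtain m :: nat and c s x where "\<forall>j<m. 0 \<le> c j \<and> s j \<in> pos_part S \<and> psd_mat n (x j)"
    "\<forall>a<n. \<forall>b<n. Z (a, b) = (\<Sum>j<m. scaleC_op (x j $$ (a, b)) (c j *\<^sub>R s j))"
    using assms(1) unfolding in_cone_iff by blast
  then show ?thesis
    unfolding in_cone_iff
    by (intro exI[of _ m] exI[of _ "\<lambda>j. r * c j"] exI[of _ s] exI[of _ x])
      (use assms(2) in \<open>simp add: scaleR_sum_right scaleC_op_scaleR\<close>)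
qed

lemma sum_lessThan_add:
  fixes f :: "nat \<Rightarrow> 'b::comm_monoid_add"
  shows "(\<Sum>j<m + k. f j) = (\<Sum>j<m. f j) + (\<Sum>j<k. f (m + j))"
  by (induction k) (auto simp: add.assoc)

lemma in_cone_plus:
  assumes "in_cone S n Y" "in_cone S n Z"
  shows "in_cone S n (Y + Z)"
proof -
  obtain m :: nat and c s x where 1: "\<forall>j<m. 0 \<le> c j \<and> s j \<in> pos_part S \<and> psd_mat n (x j)"
    "\<forall>a<n. \<forall>b<n. Y (a, b) = (\<Sum>j<m. scaleC_op (x j $$ (a, b)) (c j *\<^sub>R s j))"
    using assms(1) unfolding in_cone_iff by blast
  obtain m' :: nat and c' s' x' where 2: "\<forall>j<m'. 0 \<le> c' j \<and> s' j \<in> pos_part S \<and> psd_mat n (x' j)"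
    "\<forall>a<n. \<forall>b<n. Z (a, b) = (\<Sum>j<m'. scaleC_op (x' j $$ (a, b)) (c' j *\<^sub>R s' j))"
    using assms(2) unfolding in_cone_iff by blast
  have "0 \<le> (if j < m then c j else c' (j - m)) \<and> (if j < m then s j else s' (j - m)) \<in> pos_part S \<and>
    psd_mat n (if j < m then x j else x' (j - m))" if "j < m + m'" for j
    using 1(1) 2(1) that by auto
  then show ?thesis
    unfolding in_cone_iff
    by (intro exI[of _ "m + m'"] exI[of _ "\<lambda>j. if j < m then c j else c' (j - m)"]
        exI[of _ "\<lambda>j. if j < m then s j else s' (j - m)"] exI[of _ "\<lambda>j. if j < m then x j else x' (j - m)"])
      (simp add: 1(2) 2(2) sum_lessThan_add)
qed

lemma in_cone_entries_in:
  assumes S: "csubspace_op S" and Z: "in_cone S n Z"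
  shows "entries_in S n Z"
proof -
  have "scaleC_op d (c *\<^sub>R s) \<in> S" if "s \<in> pos_part S" for c d s
    using that S by (simp add: scaleC_op_of_real[symmetric] scaleC_op_scaleC_op csubspace_op_def pos_part_def)
  then show ?thesis
    using Z unfolding in_cone_iff entries_in_def by (auto intro!: csubspace_op_sum[OF S])
qed

text \<open>On an elementary tensor the form at h is the sum of the entrywise product of X and the
  matrix with entries \<open>cinner (h a) (s (h b))\<close>; both are positive, so
  \<open>schur_product_sum_nonneg\<close> applies.\<close>

lemma in_cone_form_pos:
  assumes Z: "in_cone S n Z"
  shows "form_pos n Z"
  unfolding form_pos_def
proof
  fix h :: "nat \<Rightarrow> 'a"
  obtain m :: nat and c s x where 1: "\<And>j. j < m \<Longrightarrow> 0 \<le> c j" "\<And>j. j < m \<Longrightarrow> s j \<in> pos_part S"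
     "\<And>j. j < m \<Longrightarrow> psd_mat n (x j)"
    and Zs: "\<forall>a<n. \<forall>b<n. Z (a, b) = (\<Sum>j<m. scaleC_op (x j $$ (a, b)) (c j *\<^sub>R s j))"
    using Z unfolding in_cone_iff by blast
  define Y where "Y = (\<lambda>j (a :: nat, b :: nat). cinner (h a) (blinfun_apply (s j) (h b)))"
  have "form_pos n (scalar_block (Y j))" if j: "j < m" for j
    unfolding form_pos_def
  proof
    fix v :: "nat \<Rightarrow> complex"
    have "pos_op (s j)" using 1(2)[OF j] by (simp add: pos_part_def)
    then have s: "s j \<in> BH" "\<And>x. 0 \<le> cinner x (blinfun_apply (s j) x)" by (auto simp: pos_op_def)
    have "qform n (scalar_block (Y j)) v v =
      cinner (\<Sum>a<n. v a *\<^sub>C h a) (blinfun_apply (s j) (\<Sum>b<n. v b *\<^sub>C h b))"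
      unfolding qform_scalar_block Y_def
      by (subst sum.swap) (simp add: blinfun.sum_right BH_apply[OF s(1)] cinner_sum_left cinner_sum_right
        cinner_scaleC_left cinner_scaleC_right sum_distrib_left mult_ac)
    then show "0 \<le> qform n (scalar_block (Y j)) v v" using s(2) by simp
  qed
  then have nn: "0 \<le> complex_of_real (c j) * (\<Sum>a<n. \<Sum>b<n. x j $$ (a, b) * Y j (a, b))" if "j < m" for j
    using that 1 schur_product_sum_nonneg[of n "($$) (x j)" "Y j"]
    by (simp add: psd_mat_iff less_eq_complex_def)
  have "qform n Z h h = (\<Sum>a<n. \<Sum>b<n. \<Sum>j<m. complex_of_real (c j) * (x j $$ (a, b) * Y j (a, b)))"
    unfolding qform_def
    by (rule sum.cong[OF refl], rule sum.cong[OF refl])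
      (simp add: Zs blinfun.sum_left cinner_sum_right cinner_scaleC_right blinfun.scaleR_left
        cinner_scaleR_right Y_def mult_ac)
  also have "\<dots> = (\<Sum>a<n. \<Sum>j<m. \<Sum>b<n. complex_of_real (c j) * (x j $$ (a, b) * Y j (a, b)))"
    by (intro sum.cong[OF refl] sum.swap)
  also have "\<dots> = (\<Sum>j<m. \<Sum>a<n. \<Sum>b<n. complex_of_real (c j) * (x j $$ (a, b) * Y j (a, b)))"
    by (rule sum.swap)
  also have "\<dots> = (\<Sum>j<m. complex_of_real (c j) * (\<Sum>a<n. \<Sum>b<n. x j $$ (a, b) * Y j (a, b)))"
    by (simp add: sum_distrib_left)
  also have "0 \<le> \<dots>" using nn by (intro sum_nonneg) auto
  finally show "0 \<le> qform n Z h h" .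
qed

text \<open>The same Schur product argument, with the positive matrix \<psi> s in place of the
  matrix of inner products.\<close>

lemma in_cone_pairing:
  assumes S: "csubspace_op S" and \<psi>: "positive_map S n \<psi>" and Z: "in_cone S n Z"
  shows "0 \<le> pairing n \<psi> Z"
proof -
  have lin: "linear_map S n \<psi>" using \<psi> by (simp add: positive_map_def)
  obtain m :: nat and c s x where 1: "\<And>j. j < m \<Longrightarrow> 0 \<le> c j" "\<And>j. j < m \<Longrightarrow> s j \<in> pos_part S"
     "\<And>j. j < m \<Longrightarrow> psd_mat n (x j)"
    and Zs: "\<forall>a<n. \<forall>b<n. Z (a, b) = (\<Sum>j<m. scaleC_op (x j $$ (a, b)) (c j *\<^sub>R s j))"
    using Z unfolding in_cone_iff by blast
  have nn: "0 \<le> complex_of_real (c j) * (\<Sum>a<n. \<Sum>b<n. x j $$ (a, b) * \<psi> (s j) $$ (a, b))" if "j < m" for j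
    using that 1 \<psi> schur_product_sum_nonneg[of n "($$) (x j)" "($$) (\<psi> (s j))"]
    by (simp add: psd_mat_iff less_eq_complex_def positive_map_def)
  have sS: "s j \<in> S" if "j < m" for j using 1(2)[OF that] by (simp add: pos_part_def)
  have "pairing n \<psi> Z = (\<Sum>a<n. \<Sum>b<n. \<Sum>j<m. complex_of_real (c j) * (x j $$ (a, b) * \<psi> (s j) $$ (a, b)))"
    unfolding pairing_def
  proof (rule sum.cong[OF refl], rule sum.cong[OF refl])
    fix a b assume "a \<in> {..<n}" "b \<in> {..<n}"
    then have ab: "a < n" "b < n" by auto
    have "Z (a, b) = (\<Sum>j<m. scaleC_op (x j $$ (a, b) * complex_of_real (c j)) (s j))"
      using Zs ab by (simp add: scaleC_op_of_real[symmetric] scaleC_op_scaleC_op)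
    then show "\<psi> (Z (a, b)) $$ (a, b) = (\<Sum>j<m. complex_of_real (c j) * (x j $$ (a, b) * \<psi> (s j) $$ (a, b)))"
      using linear_map_sum_entry[OF S lin sS ab, where c = "\<lambda>j. x j $$ (a, b) * complex_of_real (c j)" and m = m]
      by (simp add: mult_ac)
  qed
  also have "\<dots> = (\<Sum>a<n. \<Sum>j<m. \<Sum>b<n. complex_of_real (c j) * (x j $$ (a, b) * \<psi> (s j) $$ (a, b)))"
    by (intro sum.cong[OF refl] sum.swap)
  also have "\<dots> = (\<Sum>j<m. \<Sum>a<n. \<Sum>b<n. complex_of_real (c j) * (x j $$ (a, b) * \<psi> (s j) $$ (a, b)))"
    by (rule sum.swap)
  also have "\<dots> = (\<Sum>j<m. complex_of_real (c j) * (\<Sum>a<n. \<Sum>b<n. x j $$ (a, b) * \<psi> (s j) $$ (a, b)))"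
    by (simp add: sum_distrib_left)
  also have "0 \<le> \<dots>" using nn by (intro sum_nonneg) auto
  finally show ?thesis .
qed

text \<open>Boundedness of \<psi> makes the pairing continuous for the operator norm, so
  nonnegativity passes from the cone to its closure.\<close>

lemma tensor_closure_pairing:
  assumes S: "operator_system A S" and \<psi>: "positive_map S n \<psi>"
    and T: "T \<in> tensor_closure S n (pos_tensor_cone S n)"
  shows "0 \<le> pairing n \<psi> (($$) T)"
proof -
  note sub = operator_system_csubspace[OF S]
  have lin: "linear_map S n \<psi>" using \<psi> by (simp add: positive_map_def)
  obtain K where K: "0 \<le> K" "\<And>s a b. s \<in> S \<Longrightarrow> a < n \<Longrightarrow> b < n \<Longrightarrow> cmod (\<psi> s $$ (a, b)) \<le> K * norm s"
    using positive_map_bounded[OF S \<psi>] by blast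
  have TS: "T \<in> carrier_mat n n" "entries_in S n (($$) T)"
    and approx: "\<And>e. 0 < e \<Longrightarrow> \<exists>U\<in>pos_tensor_cone S n. opmat_norm n (T - U) < e"
    using T tensor_space_iff[OF sub] unfolding tensor_closure_def by auto
  \<comment> \<open>n^2 K is a Lipschitz constant of the pairing; adding 1 keeps the divisor
    positive even when n or K is 0.\<close>
  define L where "L = real n * (real n * K) + 1"
  have L: "0 < L" using K(1) by (simp add: L_def add_nonneg_pos)
  have near: "\<exists>w. 0 \<le> w \<and> cmod (pairing n \<psi> (($$) T) - w) \<le> e" if e: "0 < e" for e
  proof -
    obtain U where U: "U \<in> pos_tensor_cone S n" "opmat_norm n (T - U) < e / L"
      using approx[of "e / L"] e L by auto
    have Uc: "in_cone S n (($$) U)" using U(1) unfolding in_cone_def by auto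
    have US: "entries_in S n (($$) U)" by (rule in_cone_entries_in[OF sub Uc])
    have Um: "U \<in> carrier_mat n n" using U(1) by (auto simp: pos_tensor_cone_def)
    then have TU: "T - U \<in> carrier_mat n n" using TS by auto
    have entry: "cmod (\<psi> (T $$ (a, b)) $$ (a, b) - \<psi> (U $$ (a, b)) $$ (a, b)) \<le> K * (e / L)"
      if ab: "a < n" "b < n" for a b
    proof -
      have tu: "T $$ (a, b) \<in> S" "U $$ (a, b) \<in> S" using TS US ab by (auto simp: entries_in_def)
      then have mu: "scaleC_op (-1) (U $$ (a, b)) \<in> S" using sub by (auto simp: csubspace_op_def)
      define d where "d = T $$ (a, b) + scaleC_op (-1) (U $$ (a, b))"
      have dS: "d \<in> S" using tu mu sub by (auto simp: csubspace_op_def d_def)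
      have "scaleC_op (-1) (U $$ (a, b)) = - U $$ (a, b)"
        using scaleC_op_of_real[of "-1" "U $$ (a, b)"] by simp
      then have "d = (T - U) $$ (a, b)" using TS Um ab by (simp add: d_def)
      then have nd: "norm d \<le> e / L" using norm_entry_le_opmat_norm[OF TU ab] U(2) by simp
      have "\<psi> d $$ (a, b) = \<psi> (T $$ (a, b)) $$ (a, b) - \<psi> (U $$ (a, b)) $$ (a, b)"
        unfolding d_def linear_map_plus_entry[OF lin tu(1) mu ab] linear_map_scaleC_entry[OF lin tu(2) ab]
        by simp
      then have "cmod (\<psi> (T $$ (a, b)) $$ (a, b) - \<psi> (U $$ (a, b)) $$ (a, b)) \<le> K * norm d"
        using K(2)[OF dS ab] by simp
      also have "\<dots> \<le> K * (e / L)" using nd K(1) by (intro mult_left_mono)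
      finally show ?thesis .
    qed
    have "cmod (pairing n \<psi> (($$) T) - pairing n \<psi> (($$) U)) =
      cmod (\<Sum>a<n. \<Sum>b<n. \<psi> (T $$ (a, b)) $$ (a, b) - \<psi> (U $$ (a, b)) $$ (a, b))"
      by (simp add: pairing_def sum_subtractf)
    also have "\<dots> \<le> (\<Sum>a<n. \<Sum>b<n. K * (e / L))"
      using entry by (intro order_trans[OF norm_sum] sum_mono) auto
    also have "\<dots> = (L - 1) * (e / L)" by (simp add: L_def)
    also have "\<dots> \<le> e" using L e by (simp add: field_simps)
    finally show ?thesis using in_cone_pairing[OF sub \<psi> Uc] by blast
  qed
  let ?z = "pairing n \<psi> (($$) T)"
  have "- Re ?z \<le> 0 + e \<and> \<bar>Im ?z\<bar> \<le> 0 + e" if e: "0 < e" for e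
  proof -
    obtain w where w: "0 \<le> w" "cmod (?z - w) \<le> e" using near[OF e] by blast
    then show ?thesis using abs_Re_le_cmod[of "?z - w"] abs_Im_le_cmod[of "?z - w"]
      by (auto simp: less_eq_complex_def)
  qed
  note bound = this
  have "- Re ?z \<le> 0" "\<bar>Im ?z\<bar> \<le> 0"
    by (rule field_le_epsilon, use bound in blast)+
  then show ?thesis by (simp add: less_eq_complex_def)
qed

section \<open>Separation and splitting of functionals\<close>

definition complexify :: "((nat \<times> nat \<Rightarrow> 'h::chilbert_space \<Rightarrow>\<^sub>L 'h) \<Rightarrow> real) \<Rightarrow> (nat \<times> nat \<Rightarrow> 'h \<Rightarrow>\<^sub>L 'h) \<Rightarrow> complex"
  where "complexify g Z = complex_of_real (g Z) - \<i> * complex_of_real (g (\<lambda>p. scaleC_op \<i> (Z p)))"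

lemma complexify_plus:
  assumes "linear g"
  shows "complexify g (Y + Z) = complexify g Y + complexify g Z"
proof -
  have "(\<lambda>p. scaleC_op \<i> ((Y + Z) p)) = (\<lambda>p. scaleC_op \<i> (Y p)) + (\<lambda>p. scaleC_op \<i> (Z p))"
    by (simp add: fun_eq_iff scaleC_op_add_right)
  then show ?thesis
    using linear_add[OF assms] by (simp add: complexify_def algebra_simps)
qed

lemma complexify_zero: "linear g \<Longrightarrow> complexify g 0 = 0"
  using complexify_plus[of g 0 0] by simp

lemma complexify_sum:
  assumes "linear g"
  shows "complexify g (sum f I) = (\<Sum>i\<in>I. complexify g (f i))"
proof (induction I rule: infinite_finite_induct)
  case (infinite I)
  then show ?case by (simp only: sum.infinite[OF infinite] complexify_zero[OF assms])
next
  case empty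
  show ?case by (simp only: sum.empty complexify_zero[OF assms])
next
  case (insert i I)
  then show ?case by (simp only: sum.insert[OF insert(1,2)] complexify_plus[OF assms])
qed

lemma complexify_scaleC:
  assumes g: "linear g"
  shows "complexify g (\<lambda>p. scaleC_op c (Z p)) = c * complexify g Z"
proof -
  let ?iZ = "\<lambda>p. scaleC_op \<i> (Z p)"
  have split: "(\<lambda>p. scaleC_op d (Z p)) = Re d *\<^sub>R Z + Im d *\<^sub>R ?iZ" for d
  proof
    fix p
    have "scaleC_op d (Z p) = scaleC_op (complex_of_real (Re d) + complex_of_real (Im d) * \<i>) (Z p)"
      using complex_eq[of d] by (simp add: mult.commute)
    then show "scaleC_op d (Z p) = (Re d *\<^sub>R Z + Im d *\<^sub>R ?iZ) p"
      by (simp add: scaleC_op_add_left scaleC_op_scaleC_op[symmetric] scaleC_op_of_real)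
  qed
  have g_split: "g (\<lambda>p. scaleC_op d (Z p)) = Re d * g Z + Im d * g ?iZ" for d
    unfolding split[of d] using linear_add[OF g] linear_scale[OF g] by simp
  show ?thesis
    unfolding complexify_def scaleC_op_scaleC_op g_split[of c] g_split[of "\<i> * c"]
    by (simp add: complex_eq_iff algebra_simps)
qed

text \<open>Multiplication by i turns a real form into a purely imaginary one, where g is
  nonpositive by \<open>null\<close>; applied to i Z and to - i Z this gives g (i Z) = 0.\<close>

lemma complexify_real:
  assumes g: "linear g"
    and null: "\<And>W. (\<And>h. Re (qform n W h h) = 0) \<Longrightarrow> g W \<le> 0"
    and Z: "\<And>h. Im (qform n Z h h) = 0"
  shows "complexify g Z = complex_of_real (g Z)"
proof -
  let ?iZ = "\<lambda>p. scaleC_op \<i> (Z p)"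
  have "g ?iZ \<le> 0" by (rule null) (simp add: qform_scaleC_op Z)
  moreover have "g (- ?iZ) \<le> 0" by (rule null) (simp add: qform_uminus qform_scaleC_op Z)
  ultimately have "g ?iZ = 0" using linear_neg[OF g, of ?iZ] by simp
  then show ?thesis by (simp add: complexify_def)
qed

text \<open>Pairings see only indices below n, whereas a functional obtained from Hahn-Banach sees
  the whole function. Cutting off the rest reconciles the two without changing
  \<open>qform n\<close>.\<close>

definition truncate_block :: "nat \<Rightarrow> (nat \<times> nat \<Rightarrow> 's::zero) \<Rightarrow> nat \<times> nat \<Rightarrow> 's"
  where "truncate_block n Z = (\<lambda>(a, b). if a < n \<and> b < n then Z (a, b) else 0)"

lemma qform_truncate_block [simp]: "qform n (truncate_block n Z) g h = qform n Z g h"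
  by (rule qform_cong) (simp add: truncate_block_def)

text \<open>Inverse of the passage from maps to functionals, as
  \<open>pairing_map_of_functional\<close> shows; \<open>complexify\<close> supplies the complex
  linearity.\<close>

definition map_of_functional ::
    "nat \<Rightarrow> ((nat \<times> nat \<Rightarrow> 'h::chilbert_space \<Rightarrow>\<^sub>L 'h) \<Rightarrow> real) \<Rightarrow> ('h \<Rightarrow>\<^sub>L 'h) \<Rightarrow> complex mat"
  where "map_of_functional n g s =
    Matrix.mat n n (\<lambda>q. complexify g (\<lambda>p. if p = q then s else 0))"

lemma linear_map_of_functional:
  assumes g: "linear g"
  shows "linear_map S n (map_of_functional n g)"
proof -
  have "(\<lambda>p. if p = q then s + t else 0) = (\<lambda>p. if p = q then s else 0) + (\<lambda>p. if p = q then t else 0)"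
    for q :: "nat \<times> nat" and s t :: "'a \<Rightarrow>\<^sub>L 'a"
    by (simp add: fun_eq_iff)
  moreover have "(\<lambda>p. if p = q then scaleC_op c s else 0) = (\<lambda>p. scaleC_op c (if p = q then s else 0))"
    for q :: "nat \<times> nat" and c and s :: "'a \<Rightarrow>\<^sub>L 'a"
    by (simp add: fun_eq_iff)
  ultimately show ?thesis
    unfolding linear_map_def map_of_functional_def
    by (auto simp: complexify_plus[OF g] complexify_scaleC[OF g] intro!: eq_matI)
qed

lemma sum_fun_apply: "(sum f I) x = (\<Sum>i\<in>I. f i x)" for f :: "'i \<Rightarrow> 'a \<Rightarrow> 'b::comm_monoid_add"
  by (induction I rule: infinite_finite_induct) auto

lemma pairing_map_of_functional:
  assumes g: "linear g"
  shows "pairing n (map_of_functional n g) Z = complexify g (truncate_block n Z)"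
proof -
  let ?E = "\<lambda>a b p. if p = (a, b) then Z (a, b) else 0"
  have "truncate_block n Z = (\<Sum>a<n. \<Sum>b<n. ?E a b)"
  proof
    fix p :: "nat \<times> nat"
    obtain i j where p: "p = (i, j)" by (cases p)
    have "(\<Sum>a<n. \<Sum>b<n. ?E a b p) = (\<Sum>a<n. if a = i then if j < n then Z (i, j) else 0 else 0)"
    proof (rule sum.cong[OF refl])
      fix a
      have "(\<Sum>b<n. ?E a b p) = (\<Sum>b<n. if b = j then if a = i then Z (i, j) else 0 else 0)"
        by (rule sum.cong) (auto simp: p)
      then show "(\<Sum>b<n. ?E a b p) = (if a = i then if j < n then Z (i, j) else 0 else 0)"
        by (auto simp: sum.delta)
    qed
    then show "truncate_block n Z p = (\<Sum>a<n. \<Sum>b<n. ?E a b) p"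
      by (auto simp: sum_fun_apply sum.delta truncate_block_def p)
  qed
  then show ?thesis
    by (simp add: complexify_sum[OF g] pairing_def map_of_functional_def)
qed

lemma form_bounded_plus:
  assumes "form_bounded n r Y" "form_bounded n s Z"
  shows "form_bounded n (r + s) (Y + Z)"
  unfolding form_bounded_def
proof
  fix h
  have "\<bar>Re (qform n Y h h)\<bar> \<le> r * sqnorm n h" "\<bar>Re (qform n Z h h)\<bar> \<le> s * sqnorm n h"
    using assms unfolding form_bounded_def by blast+
  then show "\<bar>Re (qform n (Y + Z) h h)\<bar> \<le> (r + s) * sqnorm n h"
    by (simp add: qform_plus distrib_right)
qed

lemma form_bounded_scaleR:
  assumes "form_bounded n r Z"
  shows "form_bounded n (\<bar>c\<bar> * r) (c *\<^sub>R Z)"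
  unfolding form_bounded_def
proof
  fix h
  have "\<bar>c\<bar> * \<bar>Re (qform n Z h h)\<bar> \<le> \<bar>c\<bar> * (r * sqnorm n h)"
    using assms unfolding form_bounded_def by (intro mult_left_mono) auto
  then show "\<bar>Re (qform n (c *\<^sub>R Z) h h)\<bar> \<le> \<bar>c\<bar> * r * sqnorm n h"
    by (simp add: qform_scaleR abs_mult)
qed

text \<open>
  The cp part is a linear functional below the sublinear
  \<open>p x = inf {f y | y \<in> \<Gamma>P, y - x \<in> P}\<close>, which is finite because the unit is interior to both cones.
\<close>

lemma decomposableI:
  assumes S: "operator_system A S" and \<psi>: "linear_map S n \<psi>"
    and pos: "\<And>Z. entries_in S n Z \<Longrightarrow> form_pos n Z \<Longrightarrow> form_pos n (\<lambda>(a, b). Z (b, a)) \<Longrightarrow>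
      0 \<le> pairing n \<psi> Z"
  shows "decomposable S n \<psi>"
proof -
  have sub: "csubspace_op S" and one: "id_blinfun \<in> S" using S by (auto simp: operator_system_def)
  have BH: "entries_in BH n Z" if "entries_in S n Z" for Z
    using that sub by (auto simp: entries_in_def csubspace_op_def)
  \<comment> \<open>The partial transpose \<Gamma>, a linear involution that fixes the unit.\<close>
  define sw where "sw = (\<lambda>(Z :: nat \<times> nat \<Rightarrow> 'a \<Rightarrow>\<^sub>L 'a) (a, b). Z (b, a))"
  have sw_plus: "sw (Y + Z) = sw Y + sw Z" for Y Z by (auto simp: sw_def fun_eq_iff)
  have sw_scale: "sw (r *\<^sub>R Z) = r *\<^sub>R sw Z" for r Z by (auto simp: sw_def fun_eq_iff)
  have sw_unit: "sw unit_block = unit_block" by (auto simp: sw_def unit_block_def fun_eq_iff)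
  have sw_sw: "sw (sw Z) = Z" for Z by (auto simp: sw_def fun_eq_iff)
  have sw_real: "Im (qform n y h h) = 0" if "entries_in S n y" "form_pos n (sw y)" for y h
  proof -
    have "entries_in BH n (sw y)" using BH[OF entries_in_swap[OF that(1)]] by (simp add: sw_def)
    from form_real_swap[OF this form_pos_imp_real[OF that(2)], of h]
    show ?thesis by (simp add: sw_def)
  qed
  have pos: "0 \<le> pairing n \<psi> Z" if "entries_in S n Z" "form_pos n Z" "form_pos n (sw Z)" for Z
    using pos[OF that(1,2)] that(3) by (simp add: sw_def)
  note unit_S = entries_in_unit_block[OF sub one]
  have unit_pos: "0 \<le> pairing n \<psi> unit_block"
    using pos[OF unit_S form_pos_unit_block] by (simp add: sw_unit form_pos_unit_block)
  \<comment> \<open>If y lies in \<Gamma>P and is bounded below by - k, adding k times the unit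
    moves it into both cones. This estimate yields the lower bound on p as well as the reality of f
    on \<Gamma>P.\<close>
  have shifted: "0 \<le> pairing n \<psi> y + complex_of_real k * pairing n \<psi> unit_block"
    if y: "entries_in S n y" "form_pos n (sw y)" and k: "0 \<le> k"
      and le: "\<And>h. - k * sqnorm n h \<le> Re (qform n y h h)" for y k
  proof -
    have "entries_in S n (y + k *\<^sub>R unit_block)"
      by (intro entries_in_plus[OF sub] entries_in_scaleR[OF sub] y unit_S)
    moreover have "form_pos n (y + k *\<^sub>R unit_block)"
      using le sw_real[OF y]
      by (simp add: form_pos_def qform_plus qform_scaleR qform_unit_block less_eq_complex_def)
        (metis add.commute diff_ge_0_iff_ge diff_minus_eq_add)
    moreover have "form_pos n (sw (y + k *\<^sub>R unit_block))"
      unfolding sw_plus sw_scale sw_unit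
      by (intro form_pos_plus form_pos_scaleR y form_pos_unit_block k)
    ultimately have "0 \<le> pairing n \<psi> (y + k *\<^sub>R unit_block)" by (rule pos)
    then show ?thesis
      using pairing_plus[OF \<psi> y(1) entries_in_scaleR[OF sub unit_S]] pairing_scaleR[OF \<psi> unit_S]
      by metis
  qed
  \<comment> \<open>Only real parts of forms are compared, so x may be any block: its entries need
    not lie in S, and its form need not be real.\<close>
  define R where "R = (\<lambda>x r. \<exists>y. entries_in S n y \<and> form_pos n (sw y) \<and>
    (\<forall>h. Re (qform n x h h) \<le> Re (qform n y h h)) \<and> r = Re (pairing n \<psi> y))"
  obtain g where g: "linear g" and gR: "\<And>x r. R x r \<Longrightarrow> g x \<le> r"
  proof (rule Hahn_Banach_relation[of R])
    fix x x' r r' assume "R x r" "R x' r'"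
    then obtain y y' where y: "entries_in S n y" "form_pos n (sw y)"
        "\<forall>h. Re (qform n x h h) \<le> Re (qform n y h h)" "r = Re (pairing n \<psi> y)"
      and y': "entries_in S n y'" "form_pos n (sw y')"
        "\<forall>h. Re (qform n x' h h) \<le> Re (qform n y' h h)" "r' = Re (pairing n \<psi> y')"
      unfolding R_def by blast
    have "R (x + x') (r + r')"
      unfolding R_def
      using y y' by (intro exI[of _ "y + y'"])
        (auto simp: entries_in_plus[OF sub] sw_plus form_pos_plus qform_plus add_mono pairing_plus[OF \<psi>])
    then show "\<exists>u\<le>r + r'. R (x + x') u" by blast
  next
    fix x r and c :: real assume "R x r" and c: "0 < c"
    then obtain y where y: "entries_in S n y" "form_pos n (sw y)"
        "\<forall>h. Re (qform n x h h) \<le> Re (qform n y h h)" "r = Re (pairing n \<psi> y)"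
      unfolding R_def by blast
    then show "R (c *\<^sub>R x) (c * r)"
      unfolding R_def
      using c by (intro exI[of _ "c *\<^sub>R y"])
        (auto simp: entries_in_scaleR[OF sub] sw_scale form_pos_scaleR qform_scaleR pairing_scaleR[OF \<psi>])
  next
    fix x :: "nat \<times> nat \<Rightarrow> 'a \<Rightarrow>\<^sub>L 'a"
    obtain k where k: "0 \<le> k" "form_bounded n k x" using form_bounded_exists by blast
    have "Re (qform n x h h) \<le> k * sqnorm n h" for h
      using k(2) unfolding form_bounded_def by (meson abs_le_D1)
    then have "R x (Re (pairing n \<psi> (k *\<^sub>R unit_block)))"
      unfolding R_def using k
      by (intro exI[of _ "k *\<^sub>R unit_block"])
        (auto simp: entries_in_scaleR[OF sub unit_S] sw_scale sw_unit form_pos_scaleR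
          form_pos_unit_block qform_scaleR qform_unit_block)
    then show "\<exists>r. R x r" ..
    show "\<exists>b. \<forall>r. R x r \<longrightarrow> b \<le> r"
    proof (intro exI allI impI)
      fix r assume "R x r"
      then obtain y where y: "entries_in S n y" "form_pos n (sw y)"
          "\<forall>h. Re (qform n x h h) \<le> Re (qform n y h h)" "r = Re (pairing n \<psi> y)"
        unfolding R_def by blast
      have "- k * sqnorm n h \<le> Re (qform n y h h)" for h
      proof -
        have "\<bar>Re (qform n x h h)\<bar> \<le> k * sqnorm n h"
          using k(2) unfolding form_bounded_def by blast
        then show ?thesis using y(3)[rule_format, of h] by linarith
      qed
      then have "0 \<le> Re (pairing n \<psi> y) + k * Re (pairing n \<psi> unit_block)"
        using shifted[OF y(1,2) k(1)] by (simp add: less_eq_complex_def)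
      then show "- (k * Re (pairing n \<psi> unit_block)) \<le> r" using y(4) by simp
    qed
  qed blast
  have zero_S: "entries_in S n 0" using sub by (simp add: entries_in_def csubspace_op_def)
  \<comment> \<open>For such W the choice y = 0 is admissible with value 0; applied to negatives
    this makes g nonnegative on P.\<close>
  have g_nonpos: "g W \<le> 0" if "\<And>h. Re (qform n W h h) \<le> 0" for W
  proof (rule gR)
    have "pairing n \<psi> 0 = 0" using pairing_scaleR[OF \<psi> zero_S, of 0] by simp
    moreover have "sw 0 = 0" by (auto simp: sw_def fun_eq_iff)
    ultimately show "R W 0"
      unfolding R_def using that zero_S by (intro exI[of _ 0]) (simp add: form_pos_def)
  qed
  have null: "g W \<le> 0" if "\<And>h. Re (qform n W h h) = 0" for W
    using that by (intro g_nonpos) simp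
  define \<phi>\<^sub>1 where "\<phi>\<^sub>1 = map_of_functional n g"
  define \<phi>\<^sub>2 where "\<phi>\<^sub>2 = (\<lambda>s. Matrix.mat n n (\<lambda>p. \<psi> s $$ p - \<phi>\<^sub>1 s $$ p))"
  have lin1: "linear_map S n \<phi>\<^sub>1" unfolding \<phi>\<^sub>1_def by (rule linear_map_of_functional[OF g])
  have car: "\<psi> s \<in> carrier_mat n n" "\<phi>\<^sub>1 s \<in> carrier_mat n n" if "s \<in> S" for s
    using \<psi> lin1 that by (auto simp: linear_map_def)
  have lin2: "linear_map S n \<phi>\<^sub>2"
    unfolding linear_map_def \<phi>\<^sub>2_def
    by (auto intro!: eq_matI simp: linear_map_plus_entry[OF \<psi>] linear_map_plus_entry[OF lin1]
      linear_map_scaleC_entry[OF \<psi>] linear_map_scaleC_entry[OF lin1] right_diff_distrib)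
  have pairing2: "pairing n \<phi>\<^sub>2 Z = pairing n \<psi> Z - pairing n \<phi>\<^sub>1 Z" for Z
    by (simp add: pairing_def \<phi>\<^sub>2_def sum_subtractf)
  have "cp_map S n \<phi>\<^sub>1"
  proof (rule pairing_imp_cp_map[OF sub lin1])
    fix Z assume Z: "entries_in S n Z" "form_pos n Z"
    have "pairing n \<phi>\<^sub>1 Z = complex_of_real (g (truncate_block n Z))"
      unfolding \<phi>\<^sub>1_def pairing_map_of_functional[OF g]
      by (rule complexify_real[OF g null]) (auto simp: form_pos_imp_real[OF Z(2)])
    moreover have "g (- truncate_block n Z) \<le> 0"
      by (rule g_nonpos) (simp add: qform_uminus form_pos_Re[OF Z(2)])
    ultimately show "0 \<le> pairing n \<phi>\<^sub>1 Z" using linear_neg[OF g] by (simp add: less_eq_complex_def)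
  qed
  moreover have "cocp_map S n \<phi>\<^sub>2"
    unfolding cocp_map_def
  proof (intro conjI lin2)
    have lin2t: "linear_map S n (\<lambda>s. transpose_mat (\<phi>\<^sub>2 s))"
    proof -
      have "dim_row (\<phi>\<^sub>2 s) = n" "dim_col (\<phi>\<^sub>2 s) = n" for s by (simp_all add: \<phi>\<^sub>2_def)
      then show ?thesis
        unfolding linear_map_def
        by (auto intro!: eq_matI carrier_matI
          simp: linear_map_plus_entry[OF lin2] linear_map_scaleC_entry[OF lin2])
    qed
    show "cp_map S n (\<lambda>s. transpose_mat (\<phi>\<^sub>2 s))"
    proof (rule pairing_imp_cp_map[OF sub lin2t])
      fix Z assume Z: "entries_in S n Z" "form_pos n Z"
      define y where "y = sw Z"
      have y: "entries_in S n y" "form_pos n (sw y)"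
        using Z entries_in_swap[OF Z(1)] by (auto simp: y_def sw_sw) (simp add: sw_def)
      have "pairing n (\<lambda>s. transpose_mat (\<phi>\<^sub>2 s)) Z = pairing n \<phi>\<^sub>2 y"
        unfolding y_def sw_def by (rule pairing_transpose[OF lin2 Z(1)])
      also have "\<dots> = pairing n \<psi> y - complex_of_real (g (truncate_block n y))"
      proof -
        have "pairing n \<phi>\<^sub>1 y = complex_of_real (g (truncate_block n y))"
          unfolding \<phi>\<^sub>1_def pairing_map_of_functional[OF g]
          by (rule complexify_real[OF g null]) (auto simp: sw_real[OF y])
        then show ?thesis by (simp add: pairing2)
      qed
      finally have eq: "pairing n (\<lambda>s. transpose_mat (\<phi>\<^sub>2 s)) Z =
        pairing n \<psi> y - complex_of_real (g (truncate_block n y))" .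
      \<comment> \<open>Here y competes for itself: it lies in \<Gamma>P and dominates its own
        truncation. Hence g is at most f on \<Gamma>P, as the co-cp part requires.\<close>
      have "R (truncate_block n y) (Re (pairing n \<psi> y))"
        unfolding R_def using y by (intro exI[of _ y]) simp
      then have "g (truncate_block n y) \<le> Re (pairing n \<psi> y)" by (rule gR)
      \<comment> \<open>The shifted value and the value at the unit are both nonnegative, hence
        real, so their difference is real too.\<close>
      moreover have "Im (pairing n \<psi> y) = 0"
      proof -
        obtain k where k: "0 \<le> k" "form_bounded n k y" using form_bounded_exists by blast
        have "- k * sqnorm n h \<le> Re (qform n y h h)" for h
        proof -
          have "\<bar>Re (qform n y h h)\<bar> \<le> k * sqnorm n h"
            using k(2) unfolding form_bounded_def by blast
          then show ?thesis by linarith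
        qed
        then show ?thesis
          using shifted[OF y k(1)] unit_pos by (simp add: less_eq_complex_def)
      qed
      ultimately show "0 \<le> pairing n (\<lambda>s. transpose_mat (\<phi>\<^sub>2 s)) Z"
        unfolding eq by (simp add: less_eq_complex_def)
    qed
  qed
  moreover have "\<forall>s\<in>S. \<psi> s = \<phi>\<^sub>1 s + \<phi>\<^sub>2 s"
  proof
    fix s assume "s \<in> S"
    from car[OF this] show "\<psi> s = \<phi>\<^sub>1 s + \<phi>\<^sub>2 s" by (intro eq_matI) (auto simp: \<phi>\<^sub>2_def)
  qed
  ultimately show ?thesis unfolding decomposable_def by blast
qed

section \<open>Decomposable maps on J_n(S), and separation from the closed cone\<close>

lemma decomposable_pairing:
  assumes S: "csubspace_op S" and \<psi>: "decomposable S n \<psi>"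
    and Z: "entries_in S n Z" "form_pos n Z" "form_pos n (\<lambda>(a, b). Z (b, a))"
  shows "0 \<le> pairing n \<psi> Z"
proof -
  obtain \<phi>\<^sub>1 \<phi>\<^sub>2 where \<phi>: "cp_map S n \<phi>\<^sub>1" "cocp_map S n \<phi>\<^sub>2" "\<forall>s\<in>S. \<psi> s = \<phi>\<^sub>1 s + \<phi>\<^sub>2 s"
    using \<psi> unfolding decomposable_def by blast
  have lin: "linear_map S n \<phi>\<^sub>1" "linear_map S n \<phi>\<^sub>2" using \<phi> by (auto simp: cp_map_def cocp_map_def)
  have "0 \<le> pairing n (\<lambda>s. transpose_mat (\<phi>\<^sub>2 s)) (\<lambda>(a, b). Z (b, a))"
    using \<phi>(2) unfolding cocp_map_def
    by (intro cp_map_imp_pairing[OF S] entries_in_swap Z) auto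
  also have "\<dots> = pairing n \<phi>\<^sub>2 Z"
    using pairing_transpose[OF lin(2) entries_in_swap[OF Z(1)]] by simp
  finally have 2: "0 \<le> pairing n \<phi>\<^sub>2 Z" .
  have 1: "0 \<le> pairing n \<phi>\<^sub>1 Z" by (rule cp_map_imp_pairing[OF S \<phi>(1) Z(1,2)])
  have "\<psi> (Z (a, b)) $$ (a, b) = \<phi>\<^sub>1 (Z (a, b)) $$ (a, b) + \<phi>\<^sub>2 (Z (a, b)) $$ (a, b)"
    if "a < n" "b < n" for a b
  proof -
    have "Z (a, b) \<in> S" using that Z(1) by (simp add: entries_in_def)
    moreover from this have "\<phi>\<^sub>2 (Z (a, b)) \<in> carrier_mat n n" using lin(2) by (auto simp: linear_map_def)
    ultimately show ?thesis using \<phi>(3) that by simp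
  qed
  then have "pairing n \<psi> Z = pairing n \<phi>\<^sub>1 Z + pairing n \<phi>\<^sub>2 Z"
    by (simp add: pairing_def sum.distrib)
  then show ?thesis using 1 2 by simp
qed

text \<open>The functional is taken below the infimum p x of \<rho> - t e over all \<rho>, t \<ge> 0
  and U in the cone such that x + U - t T is bounded by \<rho>. This forces values \<le> 0 at - U
  and \<le> - e at T simultaneously; p is finite because T has distance at least e from the
  cone.\<close>

lemma separating_positive_map:
  assumes S: "operator_system A S" and T: "T \<in> tensor_space S n" "form_pos n (($$) T)"
    and notin: "T \<notin> tensor_closure S n (pos_tensor_cone S n)"
  obtains \<psi> where "positive_map S n \<psi>" "Re (pairing n \<psi> (($$) T)) < 0"
proof -
  note sub = operator_system_csubspace[OF S]
  have BH: "entries_in BH n Z" if "entries_in S n Z" for Z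
    using that sub by (auto simp: entries_in_def csubspace_op_def)
  have TS: "T \<in> carrier_mat n n" "entries_in S n (($$) T)" using T(1) tensor_space_iff[OF sub] by auto
  obtain e where e: "0 < e" "\<And>U. U \<in> pos_tensor_cone S n \<Longrightarrow> e \<le> opmat_norm n (T - U)"
    using notin T(1) unfolding tensor_closure_def by (auto simp: not_less)
  define Q where "Q = (\<lambda>x \<rho> t U. 0 \<le> \<rho> \<and> 0 \<le> t \<and> in_cone S n U \<and> form_bounded n \<rho> (x + U - t *\<^sub>R (($$) T)))"
  define R where "R = (\<lambda>x r. \<exists>\<rho> t U. Q x \<rho> t U \<and> r = \<rho> - t * e)"
  have RI: "R x (\<rho> - t * e)" if "Q x \<rho> t U" for x \<rho> t U
    using that unfolding R_def by blast
  obtain g where g: "linear g" and gR: "\<And>x r. R x r \<Longrightarrow> g x \<le> r"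
  proof (rule Hahn_Banach_relation[of R])
    fix x x' r r' assume "R x r" "R x' r'"
    then obtain \<rho> t U \<rho>' t' U' where q: "Q x \<rho> t U" "r = \<rho> - t * e" "Q x' \<rho>' t' U'" "r' = \<rho>' - t' * e"
      unfolding R_def by blast
    have "(x + x') + (U + U') - (t + t') *\<^sub>R (($$) T) = (x + U - t *\<^sub>R (($$) T)) + (x' + U' - t' *\<^sub>R (($$) T))"
      by (simp add: scaleR_add_left)
    moreover have "form_bounded n (\<rho> + \<rho>') ((x + U - t *\<^sub>R (($$) T)) + (x' + U' - t' *\<^sub>R (($$) T)))"
      using q unfolding Q_def by (intro form_bounded_plus) auto
    ultimately have "Q (x + x') (\<rho> + \<rho>') (t + t') (U + U')"
      using q unfolding Q_def by (simp only: in_cone_plus add_nonneg_nonneg)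
    moreover have "r + r' = (\<rho> + \<rho>') - (t + t') * e" using q by (simp add: algebra_simps)
    ultimately have "R (x + x') (r + r')" unfolding R_def by blast
    then show "\<exists>u\<le>r + r'. R (x + x') u" by blast
  next
    fix x r and c :: real assume "R x r" and c: "0 < c"
    then obtain \<rho> t U where q: "Q x \<rho> t U" "r = \<rho> - t * e" unfolding R_def by blast
    have "c *\<^sub>R x + c *\<^sub>R U - (c * t) *\<^sub>R (($$) T) = c *\<^sub>R (x + U - t *\<^sub>R (($$) T))"
      by (simp add: scaleR_add_right scaleR_diff_right)
    moreover have "form_bounded n (\<bar>c\<bar> * \<rho>) (c *\<^sub>R (x + U - t *\<^sub>R (($$) T)))"
      using q unfolding Q_def by (intro form_bounded_scaleR) auto
    ultimately have "Q (c *\<^sub>R x) (c * \<rho>) (c * t) (c *\<^sub>R U)"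
      using q c unfolding Q_def by (simp add: in_cone_scaleR)
    moreover have "c * r = c * \<rho> - (c * t) * e" by (simp add: q(2) right_diff_distrib mult.assoc)
    ultimately show "R (c *\<^sub>R x) (c * r)" unfolding R_def by blast
  next
    fix x :: "nat \<times> nat \<Rightarrow> 'a \<Rightarrow>\<^sub>L 'a"
    obtain k where k: "0 \<le> k" "form_bounded n k x" using form_bounded_exists by blast
    have "Q x k 0 0" unfolding Q_def using k by (simp add: in_cone_zero)
    from RI[OF this] show "\<exists>r. R x r" by blast
    show "\<exists>b. \<forall>r. R x r \<longrightarrow> b \<le> r"
    proof (intro exI allI impI)
      fix r assume "R x r"
      then obtain \<rho> t U where q: "Q x \<rho> t U" "r = \<rho> - t * e" unfolding R_def by blast
      show "- k \<le> r"
      proof (cases "t = 0")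
        case True
        then show ?thesis using q k unfolding Q_def by simp
      next
        case False
        then have t: "0 < t" using q unfolding Q_def by simp
        \<comment> \<open>Dividing by t makes U a competitor for the distance from T: T - U / t is
          bounded by (\<rho> + k) / t, which is therefore at least e, that is \<rho> - t e \<ge> -
          k.\<close>
        have "in_cone S n ((1 / t) *\<^sub>R U)" using q t unfolding Q_def by (intro in_cone_scaleR) auto
        then obtain V where V: "V \<in> pos_tensor_cone S n" "\<forall>a<n. \<forall>b<n. ((1 / t) *\<^sub>R U) (a, b) = V $$ (a, b)"
          unfolding in_cone_def by blast
        have Vc: "in_cone S n (($$) V)" using V(1) unfolding in_cone_def by blast
        have Vm: "V \<in> carrier_mat n n" using V(1) by (auto simp: pos_tensor_cone_def)
        have TV: "qform n (($$) (T - V)) h' h = qform n (($$) T) h' h - qform n (($$) V) h' h" for h' h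
          using TS Vm by (subst qform_minus[symmetric], intro qform_cong) auto
        have VU: "qform n (($$) V) h' h = qform n ((1 / t) *\<^sub>R U) h' h" for h' h
          using V(2) by (intro qform_cong) simp
        have "form_bounded n (\<rho> + \<bar>-1\<bar> * k) ((x + U - t *\<^sub>R (($$) T)) + (-1) *\<^sub>R x)"
          using q k unfolding Q_def by (intro form_bounded_plus form_bounded_scaleR) auto
        then have "form_bounded n (\<bar>- 1 / t\<bar> * (\<rho> + k)) ((- 1 / t) *\<^sub>R ((x + U - t *\<^sub>R (($$) T)) + (-1) *\<^sub>R x))"
          by (intro form_bounded_scaleR) simp
        then have "form_bounded n ((\<rho> + k) / t) (($$) (T - V))"
          using t unfolding form_bounded_def
          by (simp add: TV VU qform_plus qform_minus qform_scaleR qform_uminus field_simps)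
        moreover have "entries_in BH n (($$) (T - V))"
          using BH[OF TS(2)] BH[OF in_cone_entries_in[OF sub Vc]] TS(1) Vm
          by (simp add: entries_in_def BH_def blinfun.diff_left
            linear_diff[OF bounded_linear.linear[OF bounded_linear_scaleC]])
        \<comment> \<open>Passing from the numerical bound to the norm uses that the difference is
          Hermitian, which holds because T and V are both positive.\<close>
        moreover have "Im (qform n (($$) (T - V)) h h) = 0" for h
          using form_pos_imp_real[OF T(2)] form_pos_imp_real[OF in_cone_form_pos[OF Vc]] by (simp add: TV)
        ultimately have "opmat_norm n (T - V) \<le> (\<rho> + k) / t"
          using TS(1) Vm q k t unfolding Q_def by (intro opmat_norm_le) auto
        then have "e \<le> (\<rho> + k) / t" using e(2)[OF V(1)] by linarith
        then show ?thesis using t q(2) by (simp add: field_simps)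
      qed
    qed
  qed blast
  have null: "g W \<le> 0" if "\<And>h. Re (qform n W h h) = 0" for W
  proof (rule gR)
    have "Q W 0 0 0" unfolding Q_def using that by (simp add: in_cone_zero form_bounded_def)
    from RI[OF this] show "R W 0" by simp
  qed
  have cone: "0 \<le> g U" if "in_cone S n U" for U
  proof -
    have "Q (- U) 0 0 U" unfolding Q_def using that by (simp add: form_bounded_def)
    from RI[OF this] have "R (- U) 0" by simp
    then show ?thesis using gR[of "- U" 0] linear_neg[OF g] by simp
  qed
  have gT: "g (truncate_block n (($$) T)) \<le> - e"
  proof (rule gR)
    have "Q (truncate_block n (($$) T)) 0 1 0"
      unfolding Q_def by (simp add: in_cone_zero form_bounded_def qform_minus)
    from RI[OF this] show "R (truncate_block n (($$) T)) (- e)" by simp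
  qed
  let ?\<psi> = "map_of_functional n g"
  have lin: "linear_map S n ?\<psi>" by (rule linear_map_of_functional[OF g])
  have "positive_map S n ?\<psi>"
    unfolding positive_map_def
  proof (intro conjI lin ballI)
    fix s assume s: "s \<in> pos_part S"
    then have sS: "s \<in> S" by (simp add: pos_part_def)
    show "psd_mat n (?\<psi> s)"
      unfolding psd_mat_iff form_pos_def
    proof (intro conjI allI)
      show "?\<psi> s \<in> carrier_mat n n" by (simp add: map_of_functional_def)
      fix v :: "nat \<Rightarrow> complex"
      \<comment> \<open>Rank one matrix chosen so that the pairing with s \<otimes> X is the
        quadratic form of the image of s at v.\<close>
      define X where "X = Matrix.mat n n (\<lambda>(a, b). cnj (v a) * v b)"
      have X: "psd_mat n X"
        unfolding psd_mat_iff form_pos_def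
      proof (intro conjI allI)
        show "X \<in> carrier_mat n n" by (simp add: X_def)
        fix w :: "nat \<Rightarrow> complex"
        have "qform n (scalar_block (($$) X)) w w = (\<Sum>a<n. cnj (v a * w a)) * (\<Sum>b<n. v b * w b)"
          unfolding qform_scalar_block sum_product
          by (rule sum.cong[OF refl], rule sum.cong[OF refl]) (simp add: X_def)
        also have "\<dots> = complex_of_real ((cmod (\<Sum>b<n. v b * w b))\<^sup>2)"
          by (simp add: complex_norm_square[unfolded of_real_power] mult.commute)
        finally show "0 \<le> qform n (scalar_block (($$) X)) w w" by (simp add: less_eq_complex_def)
      qed
      define Z where "Z = (\<lambda>p. scaleC_op (X $$ p) s)"
      have Z: "in_cone S n Z" unfolding Z_def by (rule in_cone_tensor[OF s X])
      \<comment> \<open>\<open>in_cone\<close> compares only indices below n, so truncation stays in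
        the cone.\<close>
      then have Zc: "in_cone S n (truncate_block n Z)" by (simp add: in_cone_def truncate_block_def)
      have "qform n (scalar_block (($$) (?\<psi> s))) v v = pairing n ?\<psi> Z"
        unfolding qform_scalar_block pairing_def Z_def
        by (rule sum.cong[OF refl], rule sum.cong[OF refl])
          (simp add: linear_map_scaleC_entry[OF lin sS] X_def mult_ac)
      also have "\<dots> = complex_of_real (g (truncate_block n Z))"
        unfolding pairing_map_of_functional[OF g]
        by (rule complexify_real[OF g null]) (auto simp: form_pos_imp_real[OF in_cone_form_pos[OF Z]])
      finally show "0 \<le> qform n (scalar_block (($$) (?\<psi> s))) v v"
        using cone[OF Zc] by (simp add: less_eq_complex_def)
    qed
  qed
  moreover have "Re (pairing n ?\<psi> (($$) T)) < 0"
    unfolding pairing_map_of_functional[OF g] using gT e(1) by (simp add: complexify_def)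
  ultimately show ?thesis by (rule that)
qed

theorem theorem1p2:
  fixes A S :: "('h::chilbert_space \<Rightarrow>\<^sub>L 'h) set" and n :: nat
  assumes "unital_cstar_subalgebra A" and "operator_system A S"
  shows "(\<forall>\<psi>. positive_map S n \<psi> \<longrightarrow> decomposable S n \<psi>) \<longleftrightarrow>
    Jset n S \<subseteq> tensor_closure S n (pos_tensor_cone S n)"
proof
  note sub = operator_system_csubspace[OF assms(2)]
  assume dec: "\<forall>\<psi>. positive_map S n \<psi> \<longrightarrow> decomposable S n \<psi>"
  show "Jset n S \<subseteq> tensor_closure S n (pos_tensor_cone S n)"
  proof (rule subsetI, rule ccontr)
    fix T assume "T \<in> Jset n S" and notin: "T \<notin> tensor_closure S n (pos_tensor_cone S n)"
    then have T: "T \<in> tensor_space S n" "entries_in S n (($$) T)" "form_pos n (($$) T)"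
      "form_pos n (\<lambda>(a, b). T $$ (b, a))"
      by (auto simp: Jset_iff[OF sub] tensor_space_iff[OF sub])
    obtain \<psi> where \<psi>: "positive_map S n \<psi>" "Re (pairing n \<psi> (($$) T)) < 0"
      using separating_positive_map[OF assms(2) T(1,3) notin] by blast
    have "0 \<le> pairing n \<psi> (($$) T)"
      using dec \<psi>(1) by (intro decomposable_pairing[OF sub _ T(2,3)]) (auto simp: T(4))
    then show False using \<psi>(2) by (simp add: less_eq_complex_def)
  qed
next
  note sub = operator_system_csubspace[OF assms(2)]
  assume J: "Jset n S \<subseteq> tensor_closure S n (pos_tensor_cone S n)"
  show "\<forall>\<psi>. positive_map S n \<psi> \<longrightarrow> decomposable S n \<psi>"
  proof (intro allI impI)
    fix \<psi> assume \<psi>: "positive_map S n \<psi>"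
    show "decomposable S n \<psi>"
    proof (rule decomposableI[OF assms(2)])
      show "linear_map S n \<psi>" using \<psi> by (simp add: positive_map_def)
      fix Z assume Z: "entries_in S n Z" "form_pos n Z" "form_pos n (\<lambda>(a, b). Z (b, a))"
      \<comment> \<open>\<open>Jset\<close> and the closure consist of matrices,
        \<open>decomposableI\<close> speaks of index functions; T has the entries of Z that
        matter.\<close>
      define T where "T = Matrix.mat n n Z"
      have TZ: "T $$ (a, b) = Z (a, b)" if "a < n" "b < n" for a b using that by (simp add: T_def)
      have "form_pos n (($$) T)" "form_pos n (\<lambda>(a, b). T $$ (b, a))"
        using Z form_pos_cong[of n "($$) T" Z]
          form_pos_cong[of n "\<lambda>(a, b). T $$ (b, a)" "\<lambda>(a, b). Z (b, a)"] TZ by auto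
      then have "T \<in> Jset n S"
        using Z(1) by (simp add: Jset_iff[OF sub] entries_in_def T_def)
      then have "0 \<le> pairing n \<psi> (($$) T)"
        using J by (intro tensor_closure_pairing[OF assms(2) \<psi>]) auto
      also have "\<dots> = pairing n \<psi> Z" by (rule pairing_cong) (rule TZ)
      finally show "0 \<le> pairing n \<psi> Z" .
    qed
  qed
qed

end
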